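(* Fix admissible error metrics $d^K,d^N:[0,1]\to[0,\infty]$ and error rates $\varepsilon_K,\varepsilon_N\ge 0$. Suppose $(\mu_K^*,\mu_N^* )\in\mathcal C_K(\varepsilon_K)\times\mathcal C_N(\varepsilon_N)$ is the unique minimizer of $\mathrm{KL}(\mu_K\|\mu_N)$ over $\mathcal C_K(\varepsilon_K)\times\mathcal C_N(\varepsilon_N)$. Let $\{n_j\}$, $\{u_j\}$ be sequences of natural numbers with $n_j\to\infty$ and $n_j/u_j\to0$, and for each $j$ let $\mathcal M_j$ be a membership tester for universe $[u_j]$ and key size $n_j$ that achieves error rates $(\varepsilon_{K,j},\varepsilon_{N,j})$ under $d^K,d^N$, with $\limsup_{j\to\infty}\varepsilon_{K,j}\le\varepsilon_K$ and $\limsup_{j\to\infty}\varepsilon_{N,j}\le\varepsilon_N$. If $\{\mathcal M_j\}$ is asymptotically optimal, in the sense that $$\limsup_{j\to\infty}\frac{B(\mathcal M_j)}{n_j}=\mathrm{KL}(\mu_K^*\,\|\,\mu_N^* ),$$ then $\mu_K(\mathcal M_j)\to\mu_K^*$ and $\mu_N(\mathcal M_j)\to\mu_N^*$ in Wasserstein-1 distance.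
   Context: All logarithms are base 2; mutual information $I(\cdot;\cdot)$ and the Kullback–Leibler divergence $\mathrm{KL}$ are in bits. $\mathcal P([0,1])$ is the set of Borel probability measures on $[0,1]$. Error metrics. A pair $d^K,d^N:[0,1]\to[0,\infty]$ is admissible if both functions are nonnegative and lower semi-continuous, $d^K(1)=d^N(0)=0$, and there is $c\in[0,1]$ with $d^K(c)<\infty$ and $d^N(c)<\infty$. Feasible sets. $\mathcal C_K(\varepsilon_K)=\{\mu\in\mathcal P([0,1]):\mathbb E_{X\sim\mu}[d^K(X)]\le\varepsilon_K\}$ and $\mathcal C_N(\varepsilon_N)=\{\mu\in\mathcal P([0,1]):\mathbb E_{X\sim\mu}[d^N(X)]\le\varepsilon_N\}$. Membership testers. Let $[u]=\{1,\dots,u\}$. A membership tester $\mathcal M$ for universe $[u]$ and key size $n$ is a pair of algorithms with shared randomness: $\mathrm{Init}$ takes a key set $\mathcal K\subseteq[u]$ with $|\mathcal K|=n$ and outputs a memory state $W$; $\mathrm{Query}$ takes $i\in[u]$ and the memory state $W$ and returns a score in $[0,1]$. All testers are assumed permutation-invariant: for every permutation $\pi$ of $[u]$, every $\mathcal K$ of size $n$ and every $i\in[u]$, $\mathrm{Query}(i,\mathrm{Init}(\mathcal K))$ and $\mathrm{Query}(\pi(i),\mathrm{Init}(\pi(\mathcal K)))$ have the same distribution. Let $\mathcal K$ be a uniformly random $n$-subset of $[u]$. The memory budget of $\mathcal M$ is the mutual information $B(\mathcal M)=I(W;\mathcal K)$. Independently of the randomness of $\mathcal M$, let $J\sim\mathrm{Unif}(\mathcal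 K)$ and $J'\sim\mathrm{Unif}([u]\setminus\mathcal K)$; $\mu_K(\mathcal M)$ and $\mu_N(\mathcal M)$ are the laws of $\mathrm{Query}(J,\mathrm{Init}(\mathcal K))$ and $\mathrm{Query}(J',\mathrm{Init}(\mathcal K))$. The tester achieves error rates $(\varepsilon_K,\varepsilon_N)$ if $\mathbb E_{X\sim\mu_K(\mathcal M)}[d^K(X)]\le\varepsilon_K$ and $\mathbb E_{X\sim\mu_N(\mathcal M)}[d^N(X)]\le\varepsilon_N$.
   Formalization: The memory budget is taken as the mutual information of the key set with the pair (shared randomness, memory state W); with W alone the claim fails, since W may be encrypted by a one-time pad from the shared randomness. *)

theory Defs
  imports "HOL-Probability.Probability"
begin

section \<open>Error metrics and feasible sets\<close>

abbreviation unit_borel :: "real measure" where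
  "unit_borel \<equiv> restrict_space borel {0..1}"

abbreviation prob_measures :: "real measure set" where
  "prob_measures \<equiv> space (prob_algebra unit_borel)"

text \<open>Functions on the unit interval are total functions on the reals whose values outside
  the interval are irrelevant; accordingly, limits are taken within the interval.\<close>

definition lower_semicontinuous_unit :: "(real \<Rightarrow> ennreal) \<Rightarrow> bool" where
  "lower_semicontinuous_unit d \<longleftrightarrow>
     (\<forall>x\<in>{0..1}. \<forall>a < d x. eventually (\<lambda>y. a < d y) (at x within {0..1}))"

definition admissible :: "(real \<Rightarrow> ennreal) \<Rightarrow> (real \<Rightarrow> ennreal) \<Rightarrow> bool" where
  "admissible dK dN \<longleftrightarrow>
     lower_semicontinuous_unit dK \<and> lower_semicontinuous_unit dN \<and>
     dK 1 = 0 \<and> dN 0 = 0 \<and> (\<exists>c\<in>{0..1}. dK c < \<infinity> \<and> dN c < \<infinity>)"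

definition feasible :: "(real \<Rightarrow> ennreal) \<Rightarrow> real \<Rightarrow> real measure set" where
  "feasible d \<epsilon> = {\<mu> \<in> prob_measures. (\<integral>\<^sup>+ x. d x \<partial>\<mu>) \<le> ennreal \<epsilon>}"


section \<open>Kullback--Leibler divergence and Wasserstein distance\<close>

text \<open>The library's \<open>KL_divergence b \<nu> \<mu>\<close> is the real-valued Bochner integral of
  \<open>log b (d\<mu>/d\<nu>)\<close> against \<open>\<mu>\<close>: the reference measure comes first, and the value is
  meaningless when \<open>\<mu>\<close> is not absolutely continuous or the integral diverges. For probability
  measures the negative part of the integrand always has finite integral, so a non-integrable
  density means that the divergence is infinite.\<close>

definition KL :: "real measure \<Rightarrow> real measure \<Rightarrow> ereal" where
  "KL \<mu> \<nu> = (if absolutely_continuous \<nu> \<mu> \<and> integrable \<mu> (entropy_density 2 \<nu> \<mu>)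
             then ereal (KL_divergence 2 \<nu> \<mu>) else \<infinity>)"

definition unique_minimizer :: "('a \<Rightarrow> 'b::order) \<Rightarrow> 'a set \<Rightarrow> 'a \<Rightarrow> bool" where
  "unique_minimizer f A x \<longleftrightarrow>
     is_arg_min f (\<lambda>y. y \<in> A) x \<and> (\<forall>y. is_arg_min f (\<lambda>y. y \<in> A) y \<longrightarrow> y = x)"

definition couplings :: "real measure \<Rightarrow> real measure \<Rightarrow> (real \<times> real) measure set" where
  "couplings \<mu> \<nu> = {\<gamma> \<in> space (prob_algebra (unit_borel \<Otimes>\<^sub>M unit_borel)).
     distr \<gamma> unit_borel fst = \<mu> \<and> distr \<gamma> unit_borel snd = \<nu>}"

definition wasserstein1 :: "real measure \<Rightarrow> real measure \<Rightarrow> ennreal" where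
  "wasserstein1 \<mu> \<nu> = (INF \<gamma>\<in>couplings \<mu> \<nu>. \<integral>\<^sup>+ p. ennreal \<bar>fst p - snd p\<bar> \<partial>\<gamma>)"


section \<open>Membership testers\<close>

text \<open>\<open>shared\<close> is the law of the random string \<open>r\<close> that both algorithms can read, and
  \<open>mem\<close> is the measurable space of memory states (its measure plays no role).
  \<open>init r K\<close> is the law of the memory state and \<open>query r i w\<close> the law of the score, over
  the private coins of the respective algorithm.\<close>

record ('r, 'w) tester =
  shared :: "'r measure"
  mem :: "'w measure"
  init :: "'r \<Rightarrow> nat set \<Rightarrow> 'w measure"
  query :: "'r \<Rightarrow> nat \<Rightarrow> 'w \<Rightarrow> real measure"

definition key_sets :: "nat \<Rightarrow> nat \<Rightarrow> nat set set" where
  "key_sets u n = {K. K \<subseteq> {1..u} \<and> card K = n}"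

definition state_space :: "('r, 'w) tester \<Rightarrow> ('r \<times> 'w) measure" where
  "state_space M = shared M \<Otimes>\<^sub>M mem M"

definition state_law :: "('r, 'w) tester \<Rightarrow> nat set \<Rightarrow> ('r \<times> 'w) measure" where
  "state_law M K = shared M \<bind> (\<lambda>r. distr (init M r K) (state_space M) (Pair r))"

definition score_law :: "('r, 'w) tester \<Rightarrow> nat set \<Rightarrow> nat \<Rightarrow> real measure" where
  "score_law M K i = state_law M K \<bind> (\<lambda>(r, w). query M r i w)"

text \<open>The bounds \<open>0 < n < u\<close> say that a uniform key and a uniform non-key exist.\<close>

definition membership_tester :: "nat \<Rightarrow> nat \<Rightarrow> ('r, 'w) tester \<Rightarrow> bool" where
  "membership_tester u n M \<longleftrightarrow>
     0 < n \<and> n < u \<and> prob_space (shared M) \<and>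
     (\<forall>K\<in>key_sets u n. (\<lambda>r. init M r K) \<in> shared M \<rightarrow>\<^sub>M prob_algebra (mem M)) \<and>
     (\<forall>i\<in>{1..u}. (\<lambda>(r, w). query M r i w) \<in> state_space M \<rightarrow>\<^sub>M prob_algebra unit_borel) \<and>
     (\<forall>\<pi>. \<pi> permutes {1..u} \<longrightarrow>
        (\<forall>K\<in>key_sets u n. \<forall>i\<in>{1..u}. score_law M (\<pi> ` K) (\<pi> i) = score_law M K i))"

definition key_score_law :: "nat \<Rightarrow> nat \<Rightarrow> ('r, 'w) tester \<Rightarrow> real measure" where
  "key_score_law u n M =
     uniform_count_measure (key_sets u n) \<bind> (\<lambda>K.
     uniform_count_measure K \<bind> (\<lambda>J. score_law M K J))"

definition nonkey_score_law :: "nat \<Rightarrow> nat \<Rightarrow> ('r, 'w) tester \<Rightarrow> real measure" where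
  "nonkey_score_law u n M =
     uniform_count_measure (key_sets u n) \<bind> (\<lambda>K.
     uniform_count_measure ({1..u} - K) \<bind> (\<lambda>J. score_law M K J))"

definition achieves_error_rates ::
  "(real \<Rightarrow> ennreal) \<Rightarrow> (real \<Rightarrow> ennreal) \<Rightarrow> nat \<Rightarrow> nat \<Rightarrow> ('r, 'w) tester \<Rightarrow> real \<Rightarrow> real \<Rightarrow> bool"
  where
  "achieves_error_rates dK dN u n M \<epsilon>K \<epsilon>N \<longleftrightarrow>
     (\<integral>\<^sup>+ x. dK x \<partial>key_score_law u n M) \<le> ennreal \<epsilon>K \<and>
     (\<integral>\<^sup>+ x. dN x \<partial>nonkey_score_law u n M) \<le> ennreal \<epsilon>N"

text \<open>Joint law of the state and the uniformly random key set.\<close>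

definition joint_law :: "nat \<Rightarrow> nat \<Rightarrow> ('r, 'w) tester \<Rightarrow> (('r \<times> 'w) \<times> nat set) measure" where
  "joint_law u n M =
     uniform_count_measure (key_sets u n) \<bind> (\<lambda>K.
       distr (state_law M K) (state_space M \<Otimes>\<^sub>M count_space (key_sets u n)) (\<lambda>s. (s, K)))"

text \<open>The memory state \<open>W\<close> in \<open>I(W; K)\<close> is everything handed from initialization to query,
  i.e. the pair of the shared string and the stored memory. The string is independent of the key
  set and hence free: by the chain rule this is the mutual information of stored memory and key
  set conditional on the string, and with trivial shared randomness it is the mutual information
  of the stored memory itself. Leaving the string out would be wrong: encrypting the stored
  memory with it as a one-time pad would bring the budget of an exact tester down to \<open>0\<close>.
  The library's real-valued mutual information is adequate since there are only finitely many
  key sets, which makes it finite.\<close>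

definition memory_budget :: "nat \<Rightarrow> nat \<Rightarrow> ('r, 'w) tester \<Rightarrow> real" where
  "memory_budget u n M = prob_space.mutual_information (joint_law u n M) 2
     (state_space M) (count_space (key_sets u n)) fst snd"

end

theory Submission
  imports Defs
begin

text \<open>By the variational formula, \<open>KL \<mu> \<nu>\<close> (in nats) is the supremum of
  \<open>\<integral> f d\<mu> - \<integral> exp f d\<nu> + 1\<close> over bounded measurable \<open>f\<close>; on the unit interval
  continuous \<open>f\<close> suffice, so \<open>KL\<close> is lower semicontinuous under weak convergence.
  Applied to the joint law of state and key set against the product of its marginals, with a sum of
  per-key scores as the test function, the same formula bounds the memory budget per key from below by
  the variational expression for the key and non-key score laws, up to a term of order \<open>n / u\<close>.
  The probability measures on the unit interval being weakly compact, every subsequence of the pairs of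
  score laws has a weak limit point; it is feasible by lower semicontinuity of the error functionals, and
  its divergence is at most the limit superior of the budgets. So it is a minimizer and hence equals the
  unique one. Weak convergence on the unit interval implies Wasserstein convergence because
  Skorohod's theorem provides the couplings.\<close>

section \<open>The variational formula for the Kullback--Leibler divergence\<close>

text \<open>The affine form of the variational formula, with
  \<open>\<integral> exp f d\<nu> - 1\<close> in place of the logarithm of the integral, is the
  integrated Fenchel-Young inequality between \<open>exp\<close> and its conjugate
  \<open>y ln y - y\<close>. It loses nothing in the supremum, and being affine in the pair of
  measures it survives averaging over key sets and weak limits term by term. The term of order
  \<open>n / u\<close> has this origin: the normaliser of the test function sums over the whole
  universe, so the \<open>n\<close> true keys enter it with weight \<open>n / (u - n)\<close> beside
  the non-keys. That weight multiplies \<open>\<integral> exp f\<close> under the key score law,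
  which is at most \<open>exp B\<close> when \<open>\<bar>f\<bar> \<le> B\<close>. Hence the order
  of limits: \<open>f\<close> is fixed and bounded while the sizes grow, and the supremum over
  \<open>f\<close> is taken only in the limit. The reduction from measurable to bounded continuous
  test functions is therefore carried out for the limit pair, under both of its measures at
  once.\<close>

lemma young_ln_exp:
  fixes y F :: real
  assumes "0 \<le> y"
  shows "y * F - exp F \<le> y * ln y - y"
proof (cases "y = 0")
  case False
  with assms have y: "0 < y" by simp
  \<comment> \<open>This is \<open>ln z \<le> z - 1\<close> at \<open>z = exp F / y\<close>, with
    equality at \<open>F = ln y\<close>; so the optimal test function is the logarithm of the
    density.\<close>
  have "F - ln y \<le> exp F / y - 1"
    using ln_le_minus_one[of "exp F / y"] y by (simp add: ln_div)
  then have "y * (F - ln y) \<le> y * (exp F / y - 1)"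
    using y by (intro mult_left_mono) auto
  with y show ?thesis by (simp add: algebra_simps)
qed simp

lemma bounded_measurable_integrable:
  fixes F :: "'a \<Rightarrow> real"
  assumes "finite_measure N" "sets N = sets M" "F \<in> borel_measurable M"
    and "\<And>x. x \<in> space M \<Longrightarrow> \<bar>F x\<bar> \<le> B"
  shows "integrable N F"
proof -
  interpret finite_measure N by fact
  have "F \<in> borel_measurable N" using assms(3) assms(2) measurable_cong_sets by blast
  then show ?thesis
    using assms(4) sets_eq_imp_space_eq[OF assms(2)] by (intro integrable_const_bound[where B=B]) auto
qed

lemma exp_bounded_measurable_integrable:
  fixes F :: "'a \<Rightarrow> real"
  assumes "finite_measure N" "sets N = sets M" "F \<in> borel_measurable M"
    and "\<And>x. x \<in> space M \<Longrightarrow> \<bar>F x\<bar> \<le> B"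
  shows "integrable N (\<lambda>x. exp (F x))"
proof (rule bounded_measurable_integrable[OF assms(1,2)])
  show "(\<lambda>x. exp (F x)) \<in> borel_measurable M" using assms(3) by measurable
  show "\<bar>exp (F x)\<bar> \<le> exp B" if "x \<in> space M" for x using assms(4)[OF that] by auto
qed

text \<open>With \<open>g\<close> the density of \<open>P\<close> with respect to \<open>R\<close>,
  \<open>young_ln_exp\<close> at \<open>y = g x\<close> is integrated against \<open>R\<close>. The
  density turns \<open>g * F\<close> into an integral against \<open>P\<close>,
  \<open>\<integral> g dR = 1\<close> accounts for the \<open>+ 1\<close>, and \<open>ln b\<close>
  converts from base \<open>b\<close> to nats.\<close>

lemma KL_divergence_variational_lower:
  fixes F :: "'a \<Rightarrow> real"
  assumes R: "prob_space R" and P: "prob_space P" and sets: "sets P = sets R" and b: "1 < b"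
    and ac: "absolutely_continuous R P" and int: "integrable P (entropy_density b R P)"
    and F: "F \<in> borel_measurable R" "\<And>x. x \<in> space R \<Longrightarrow> \<bar>F x\<bar> \<le> B"
  shows "(\<integral>x. F x \<partial>P) - (\<integral>x. exp (F x) \<partial>R) + 1 \<le> ln b * KL_divergence b R P"
proof -
  interpret R: prob_space R by fact
  interpret P: prob_space P by fact
  define g where "g x = enn2real (RN_deriv R P x)" for x
  have g[measurable]: "g \<in> borel_measurable R" unfolding g_def by measurable
  note [measurable] = F(1)
  have sf: "sigma_finite_measure P" by unfold_locales
  note RNI = R.RN_deriv_integrable[OF sf ac sets, folded g_def]
  note RNE = R.RN_deriv_integral[OF sf ac sets, folded g_def]
  have intF: "integrable P F" by (rule bounded_measurable_integrable[OF P.finite_measure_axioms sets F])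
  have intE: "integrable R (\<lambda>x. exp (F x))"
    by (rule exp_bounded_measurable_integrable[OF R.finite_measure_axioms refl F])
  have ln_eq: "ln b * entropy_density b R P x = ln (g x)" for x
    using b by (simp add: entropy_density_def g_def log_def)
  have intln: "integrable P (\<lambda>x. ln (g x))"
    using integrable_mult_right[OF int, of "ln b"] by (simp add: ln_eq)
  have 1: "integrable R (\<lambda>x. g x * F x)" using RNI[of F] intF by auto
  have 2: "integrable R (\<lambda>x. g x * ln (g x))" using RNI[of "\<lambda>x. ln (g x)"] intln by auto
  have 3: "integrable R g" using RNI[of "\<lambda>x. 1"] by auto
  have "(\<integral>x. g x \<partial>R) = 1" using RNE[of "\<lambda>x. 1"] by (simp add: P.prob_space)
  moreover have "(\<integral>x. g x * F x - exp (F x) \<partial>R) \<le> (\<integral>x. g x * ln (g x) - g x \<partial>R)"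
    by (intro integral_mono Bochner_Integration.integrable_diff 1 2 3 intE young_ln_exp)
       (simp add: g_def)
  moreover have "(\<integral>x. g x * F x \<partial>R) = (\<integral>x. F x \<partial>P)" using RNE[of F] by simp
  moreover have "(\<integral>x. g x * ln (g x) \<partial>R) = (\<integral>x. ln (g x) \<partial>P)" using RNE[of "\<lambda>x. ln (g x)"] by simp
  moreover have "(\<integral>x. ln (g x) \<partial>P) = ln b * KL_divergence b R P"
    unfolding KL_divergence_def by (simp flip: ln_eq)
  ultimately show ?thesis using 1 2 3 intE by simp
qed

text \<open>Truncations of the log-density come arbitrarily close to the supremum. The first two
  conclusions are as important as the bound: they certify that \<open>KL_divergence\<close> is a
  genuine finite divergence rather than the default value of a Bochner integral.\<close>

lemma KL_divergence_variational_upper: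
  fixes P R :: "'a measure"
  assumes R: "prob_space R" and P: "prob_space P" and sets: "sets P = sets R" and b: "1 < b"
    and bound: "\<And>F B. F \<in> borel_measurable R \<Longrightarrow> (\<And>x. \<bar>F x\<bar> \<le> B) \<Longrightarrow>
       (\<integral>x. F x \<partial>P) - (\<integral>x. exp (F x) \<partial>R) + 1 \<le> C"
  shows "absolutely_continuous R P"
    and "integrable P (entropy_density b R P)"
    and "ln b * KL_divergence b R P \<le> C"
proof -
  interpret R: prob_space R by fact
  interpret P: prob_space P by fact
  note [measurable_cong] = sets
  show ac: "absolutely_continuous R P"
    unfolding absolutely_continuous_def
  proof
    fix A assume A: "A \<in> null_sets R"
    then have [measurable]: "A \<in> sets R" by auto
    \<comment> \<open>On an \<open>R\<close>-null set the exponential term does not notice the test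
      function \<open>t * indicator A\<close>, while the linear term grows with \<open>t\<close>; a
      bound uniform in \<open>t\<close> leaves no mass for \<open>P\<close> on
      \<open>A\<close>.\<close>
    have *: "t * P.prob A \<le> C" for t :: real
    proof -
      have "AE x in R. x \<notin> A" using A by (rule AE_not_in)
      then have "AE x in R. exp (t * indicator A x) = 1" by eventually_elim simp
      then have "(\<integral>x. exp (t * indicator A x) \<partial>R) = (\<integral>x. 1 \<partial>R)"
        by (intro integral_cong_AE) auto
      moreover have "(\<integral>x. t * indicator A x \<partial>P) - (\<integral>x. exp (t * indicator A x) \<partial>R) + 1 \<le> C"
        by (rule bound[where B="\<bar>t\<bar>"]) (auto split: split_indicator)
      ultimately show ?thesis by (simp add: R.prob_space)
    qed
    have "P.prob A = 0"
    proof (rule ccontr)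
      assume "P.prob A \<noteq> 0"
      then show False using *[of "(C + 1) / P.prob A"] by simp
    qed
    then show "A \<in> null_sets P" by (auto simp: P.emeasure_eq_measure sets)
  qed
  define g where "g x = enn2real (RN_deriv R P x)" for x
  have g[measurable]: "g \<in> borel_measurable R" unfolding g_def by measurable
  have g0: "0 \<le> g x" for x by (simp add: g_def)
  have sf: "sigma_finite_measure P" by unfold_locales
  note RNI = R.RN_deriv_integrable[OF sf ac sets, folded g_def]
  note RNE = R.RN_deriv_integral[OF sf ac sets, folded g_def]
  have g_int: "integrable R g" using RNI[of "\<lambda>x. 1"] by auto
  have g_1: "(\<integral>x. g x \<partial>R) = 1" using RNE[of "\<lambda>x. 1"] by (simp add: P.prob_space)
  have ln_eq: "ln b * entropy_density b R P x = ln (g x)" for x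
    using b by (simp add: entropy_density_def g_def log_def)
  \<comment> \<open>\<open>P\<close> gives \<open>{g = 0}\<close> the mass
    \<open>\<integral> g dR\<close> over that set, which is zero. Pointwise limits of the
    truncations are thus needed only where \<open>g\<close> is positive.\<close>
  have g_pos: "AE x in P. 0 < g x"
  proof -
    have "{x \<in> space R. g x = 0} \<in> sets P" by measurable
    then have "P.prob {x \<in> space R. g x = 0} = (\<integral>x. g x * indicator {x \<in> space R. g x = 0} x \<partial>R)"
      using RNE[of "indicator {x \<in> space R. g x = 0}"] sets_eq_imp_space_eq[OF sets] by simp
    also have "\<dots> = 0" by (rule integral_eq_zero_AE) (auto split: split_indicator)
    finally have "{x \<in> space R. g x = 0} \<in> null_sets P"
      using \<open>_ \<in> sets P\<close> by (auto simp: P.emeasure_eq_measure)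
    then have "AE x in P. x \<notin> {x \<in> space R. g x = 0}" by (rule AE_not_in)
    then show ?thesis using AE_space[of P]
      by eventually_elim (use g0 sets_eq_imp_space_eq[OF sets] in \<open>auto simp: less_le\<close>)
  qed
  \<comment> \<open>The value \<open>- real k\<close> at zeros of \<open>g\<close> overrides the
    convention \<open>ln 0 = 0\<close>. Those points are \<open>P\<close>-null but need not be
    \<open>R\<close>-null, and only with this value does \<open>exp (f k x)\<close> tend to
    \<open>g x\<close> at all of them.\<close>
  define f where "f k x = (if g x = 0 then - real k else max (- real k) (min (real k) (ln (g x))))" for k x
  have f[measurable]: "f k \<in> borel_measurable R" for k unfolding f_def by measurable
  have fB: "\<bar>f k x\<bar> \<le> real k" for k x by (auto simp: f_def)
  have f_int: "integrable P (f k)" for k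
    by (rule bounded_measurable_integrable[OF P.finite_measure_axioms sets f fB])
  have e_int: "integrable R (\<lambda>x. exp (f k x))" for k
    by (rule exp_bounded_measurable_integrable[OF R.finite_measure_axioms refl f fB])
  have e_le: "exp (f k x) \<le> 1 + g x" for k x
  proof (cases "g x = 0")
    case False
    then have "g x > 0" using g0[of x] by simp
    moreover have "f k x \<le> max 0 (ln (g x))" using False by (auto simp: f_def)
    ultimately show ?thesis
      by (smt (verit) exp_le_cancel_iff exp_ln exp_zero)
  qed (simp add: f_def)
  have e_lim: "(\<lambda>k. exp (f k x)) \<longlonglongrightarrow> g x" for x
  proof (cases "g x = 0")
    case True
    then show ?thesis unfolding f_def
      by (auto intro!: filterlim_compose[OF exp_at_bot] filterlim_compose[OF filterlim_uminus_at_bot_at_top] filterlim_real_sequentially)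
  next
    case False
    then have "g x > 0" using g0[of x] by simp
    have "eventually (\<lambda>k. real k \<ge> \<bar>ln (g x)\<bar>) sequentially" by real_asymp
    then have "eventually (\<lambda>k. f k x = ln (g x)) sequentially"
      by eventually_elim (use \<open>g x > 0\<close> in \<open>auto simp: f_def\<close>)
    then have "eventually (\<lambda>k. exp (f k x) = g x) sequentially"
      by eventually_elim (use \<open>g x > 0\<close> in auto)
    then show ?thesis by (rule tendsto_eventually)
  qed
  have f_lim: "(\<lambda>k. f k x) \<longlonglongrightarrow> ln (g x)" if "0 < g x" for x
    using tendsto_ln[OF e_lim, of x] that by simp
  have f_abs: "\<bar>f k x\<bar> \<le> \<bar>ln (g x)\<bar>" if "0 < g x" for k x
    using that by (auto simp: f_def max_def min_def)
  have e_lim': "(\<lambda>k. \<integral>x. exp (f k x) \<partial>R) \<longlonglongrightarrow> 1"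
    unfolding g_1[symmetric]
    by (rule integral_dominated_convergence[where w="\<lambda>x. 1 + g x"])
       (use g_int e_lim e_le in auto)
  have e_le': "(\<integral>x. exp (f k x) \<partial>R) \<le> 2" for k
  proof -
    have "(\<integral>x. exp (f k x) \<partial>R) \<le> (\<integral>x. 1 + g x \<partial>R)"
      by (intro integral_mono e_int e_le) (use g_int in auto)
    then show ?thesis using g_int g_1 by (simp add: R.prob_space)
  qed
  have bk: "(\<integral>x. f k x \<partial>P) - (\<integral>x. exp (f k x) \<partial>R) + 1 \<le> C" for k
    by (rule bound[OF f fB])
  \<comment> \<open>\<open>young_ln_exp\<close> at \<open>F = 0\<close> gives
    \<open>- y * ln y \<le> 1 - y\<close>, so negative parts cost at most \<open>1\<close> under
    \<open>P\<close>, uniformly in \<open>k\<close>.\<close>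
  have neg_le: "g x * max 0 (- f k x) \<le> 1" for k x
  proof (cases "g x = 0")
    case False
    then have gx: "g x > 0" using g0[of x] by simp
    have "max 0 (- f k x) \<le> max 0 (- ln (g x))" using False by (auto simp: f_def)
    then have "g x * max 0 (- f k x) \<le> g x * max 0 (- ln (g x))"
      using g0 by (intro mult_left_mono) auto
    also have "\<dots> \<le> 1" using young_ln_exp[of "g x" 0] gx by (auto simp: max_def)
    finally show ?thesis .
  qed simp
  \<comment> \<open>The constant: \<open>\<integral> f k dP \<le> C + 2 - 1\<close> by
    \<open>bk\<close> and \<open>e_le'\<close>, and twice the negative part adds at most
    \<open>2\<close>.\<close>
  have abs_le: "(\<integral>x. \<bar>f k x\<bar> \<partial>P) \<le> C + 3" for k
  proof -
    have n: "integrable P (\<lambda>x. max 0 (- f k x))"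
      by (rule bounded_measurable_integrable[OF P.finite_measure_axioms sets, where B="real k"])
         (use fB[of k] in \<open>auto simp: max_def\<close>, smt (verit))
    have "(\<integral>x. max 0 (- f k x) \<partial>P) = (\<integral>x. g x * max 0 (- f k x) \<partial>R)"
      by (rule RNE) measurable
    also have "\<dots> \<le> (\<integral>x. 1 \<partial>R)"
      by (intro integral_mono neg_le) (use RNI[of "\<lambda>x. max 0 (- f k x)"] n in auto)
    also have "\<dots> = 1" by (simp add: R.prob_space)
    finally have "(\<integral>x. max 0 (- f k x) \<partial>P) \<le> 1" .
    moreover have "(\<integral>x. \<bar>f k x\<bar> \<partial>P) = (\<integral>x. f k x + 2 * max 0 (- f k x) \<partial>P)"
      by (rule Bochner_Integration.integral_cong) auto
    ultimately show ?thesis using bk[of k] e_le'[of k] n f_int[of k] by simp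
  qed
  \<comment> \<open>The natural dominating function is \<open>\<bar>ln g\<bar>\<close>, whose
    integrability is the claim. Fatou's lemma with the uniform bound \<open>C + 3\<close> breaks the
    circle and makes dominated convergence available below.\<close>
  have intln: "integrable P (\<lambda>x. ln (g x))"
  proof (rule integrableI_bounded)
    have "(\<integral>\<^sup>+ x. ennreal (norm (ln (g x))) \<partial>P) = (\<integral>\<^sup>+ x. liminf (\<lambda>k. ennreal \<bar>f k x\<bar>) \<partial>P)"
    proof (rule nn_integral_cong_AE, use g_pos in eventually_elim)
      case (elim x)
      have "(\<lambda>k. ennreal \<bar>f k x\<bar>) \<longlonglongrightarrow> ennreal \<bar>ln (g x)\<bar>"
        by (intro tendsto_ennrealI tendsto_rabs f_lim elim)
      from lim_imp_Liminf[OF sequentially_bot this] show ?case by simp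
    qed
    also have "\<dots> \<le> liminf (\<lambda>k. \<integral>\<^sup>+ x. ennreal \<bar>f k x\<bar> \<partial>P)"
      by (rule nn_integral_liminf) measurable
    also have "\<dots> \<le> ennreal (C + 3)"
    proof -
      have "(\<integral>\<^sup>+ x. ennreal \<bar>f k x\<bar> \<partial>P) \<le> ennreal (C + 3)" for k
      using abs_le[of k] f_int[of k] by (subst nn_integral_eq_integral) (auto intro: ennreal_leI)
    then show "liminf (\<lambda>k. \<integral>\<^sup>+ x. ennreal \<bar>f k x\<bar> \<partial>P) \<le> ennreal (C + 3)"
      using Liminf_mono[of _ "\<lambda>_. ennreal (C + 3)" sequentially] by (simp add: Liminf_const)
    qed
    finally have "(\<integral>\<^sup>+ x. ennreal (norm (ln (g x))) \<partial>P) \<le> ennreal (C + 3)" .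
    then show "(\<integral>\<^sup>+ x. ennreal (norm (ln (g x))) \<partial>P) < \<infinity>"
      by (rule order.strict_trans1) simp
  qed measurable
  have "integrable P (\<lambda>x. (1 / ln b) * ln (g x))" using intln by (rule integrable_mult_right)
  then show "integrable P (entropy_density b R P)"
    using b by (simp flip: ln_eq)
  have "(\<lambda>k. \<integral>x. f k x \<partial>P) \<longlonglongrightarrow> (\<integral>x. ln (g x) \<partial>P)"
    by (rule integral_dominated_convergence[where w="\<lambda>x. \<bar>ln (g x)\<bar>"])
       (use intln g_pos f_lim f_abs in \<open>auto elim!: eventually_mono\<close>)
  then have "(\<lambda>k. (\<integral>x. f k x \<partial>P) - (\<integral>x. exp (f k x) \<partial>R) + 1) \<longlonglongrightarrow> (\<integral>x. ln (g x) \<partial>P) - 1 + 1"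
    by (intro tendsto_intros e_lim')
  then have "(\<integral>x. ln (g x) \<partial>P) \<le> C"
    using bk by (intro LIMSEQ_le_const2[of _ "(\<integral>x. ln (g x) \<partial>P)"]) auto
  then show "ln b * KL_divergence b R P \<le> C"
    unfolding KL_divergence_def by (simp flip: ln_eq)
qed

section \<open>Reduction to continuous test functions\<close>

text \<open>The gap \<open>U - K\<close> is the only place where a Urysohn function for
  \<open>K\<close> inside \<open>U\<close> can differ from the indicator of \<open>A\<close>. Inner
  and outer approximation each spend \<open>e / 3\<close>.\<close>

lemma regular_between:
  fixes N :: "'a::{second_countable_topology, complete_space} measure"
  assumes "finite_measure N" and sets: "sets N = sets borel" and A: "A \<in> sets N" and "0 < e"
  obtains K U where "compact K" "open U" "K \<subseteq> A" "A \<subseteq> U" "measure N (U - K) < e"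
proof -
  interpret finite_measure N by fact
  have fin: "emeasure N (space N) \<noteq> \<infinity>" by simp
  have Ab: "A \<in> sets borel" using A sets by simp
   have e: "0 < e / 3" "e / 3 \<ge> 0" using \<open>0 < e\<close> by auto
  have "\<exists>K\<in>{K. K \<subseteq> A \<and> compact K}. emeasure N A < emeasure N K + ennreal (e / 3)"
    by (rule SUP_approx_ennreal[OF e(1) _ inner_regular[OF sets fin Ab]])
      (use emeasure_finite in \<open>auto intro!: exI[of _ "{}"]\<close>)
  then obtain K where K: "compact K" "K \<subseteq> A" "emeasure N A < emeasure N K + ennreal (e / 3)"
    by auto
  have "\<exists>U\<in>{U. A \<subseteq> U \<and> open U}. emeasure N U < emeasure N A + ennreal (e / 3)"
    by (rule INF_approx_ennreal[OF _ outer_regular[OF sets fin Ab]]) (use e emeasure_finite in auto)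
  then obtain U where U: "open U" "A \<subseteq> U" "emeasure N U < emeasure N A + ennreal (e / 3)"
    by auto
  have [measurable]: "K \<in> sets N" "U \<in> sets N" using K(1) U(1) sets by (auto intro: borel_compact)
  have 1: "measure N A < measure N K + e / 3"
    using K(3) e by (simp add: emeasure_eq_measure ennreal_less_iff flip: ennreal_plus)
  have 2: "measure N U < measure N A + e / 3"
    using U(3) e by (simp add: emeasure_eq_measure ennreal_less_iff flip: ennreal_plus)
  have "measure N (U - K) = measure N U - measure N K"
    using K U by (intro finite_measure_Diff) auto
  then have "measure N (U - K) < e" using 1 2 \<open>0 < e\<close> by linarith
  with K U that show thesis by blast
qed

text \<open>Induction over integrable functions: regularity and a Urysohn function settle multiples
  of indicators, the triangle inequality settles sums, and dominated convergence settles
  limits.\<close>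

lemma continuous_dense_L1:
  fixes h :: "'a::euclidean_space \<Rightarrow> real"
  assumes "finite_measure N" and sets: "sets N = sets borel" and "integrable N h" and "0 < e"
  shows "\<exists>g. continuous_on UNIV g \<and> bounded (range g) \<and> (\<integral>x. \<bar>h x - g x\<bar> \<partial>N) < e"
  using assms(3,4)
proof (induction h arbitrary: e)
  interpret finite_measure N by fact
  note [measurable_cong] = sets
  have cint: "integrable N g" if g: "continuous_on UNIV g" "bounded (range g)" for g :: "'a \<Rightarrow> real"
  proof -
    obtain B where "\<And>x. \<bar>g x\<bar> \<le> B" using g(2) by (auto simp: bounded_iff)
    then show ?thesis
      by (intro integrable_const_bound[where B=B])
         (use g in \<open>auto intro!: borel_measurable_continuous_onI simp: measurable_cong_sets[OF sets refl]\<close>)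
  qed
  have ind: "integrable N (indicator X :: 'a \<Rightarrow> real)" if "X \<in> sets N" for X
    using that by (intro integrable_real_indicator) (auto simp: less_top[symmetric])
  {
    case (base A c)
    \<comment> \<open>The summand \<open>1\<close> keeps \<open>\<bar>c\<bar> * d < e\<close> valid
      for \<open>c = 0\<close> as well.\<close>
    define d where "d = e / (\<bar>c\<bar> + 1)"
    have "0 < d" using base by (simp add: d_def)
    obtain K U where KU: "compact K" "open U" "K \<subseteq> A" "A \<subseteq> U" "measure N (U - K) < d"
      using regular_between[OF assms(1) sets base(1) \<open>0 < d\<close>] by blast
    have UK[measurable]: "U - K \<in> sets N" using KU(1,2) unfolding sets
      by (intro sets.Diff) (auto intro: borel_compact)
    obtain f :: "'a \<Rightarrow> real" where f: "continuous_on UNIV f" "\<And>x. f x \<in> closed_segment 0 1"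
      "\<And>x. f x = 0 \<longleftrightarrow> x \<in> - U" "\<And>x. f x = 1 \<longleftrightarrow> x \<in> K"
      by (rule Urysohn_strong[of "- U" K 0 1]) (use KU in \<open>auto simp: compact_imp_closed\<close>)
    have f01: "0 \<le> f x" "f x \<le> 1" for x using f(2)[of x] by (auto simp: closed_segment_eq_real_ivl)
    define g where "g x = f x * c" for x
    have g: "continuous_on UNIV g" unfolding g_def by (intro continuous_intros f)
    have bg: "bounded (range g)"
      unfolding bounded_iff g_def using f01 by (auto simp: abs_mult intro!: exI[of _ "\<bar>c\<bar>"] mult_left_le_one_le)
    have le: "\<bar>indicator A x *\<^sub>R c - g x\<bar> \<le> \<bar>c\<bar> * indicator (U - K) x" for x
    proof (cases "x \<in> U - K")
      case True
      have "\<bar>indicator A x *\<^sub>R c - g x\<bar> = \<bar>indicator A x - f x\<bar> * \<bar>c\<bar>"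
        by (simp add: g_def algebra_simps flip: abs_mult)
      also have "\<dots> \<le> 1 * \<bar>c\<bar>"
        using f01[of x] by (intro mult_right_mono) (auto split: split_indicator)
      finally show ?thesis using True by simp
    next
      case False
      then have "indicator A x = (f x :: real)" using f(3,4)[of x] KU by (auto split: split_indicator)
      then show ?thesis using False by (simp add: g_def)
    qed
    have "(\<integral>x. \<bar>indicator A x *\<^sub>R c - g x\<bar> \<partial>N) \<le> (\<integral>x. \<bar>c\<bar> * indicator (U - K) x \<partial>N)"
      by (rule integral_mono[OF _ _ le]) (use cint[OF g bg] ind base(1) UK in auto)
    also have "\<dots> = \<bar>c\<bar> * measure N (U - K)" using sets.sets_into_space[OF UK] by (simp add: Int_absorb2)
    also have "\<dots> \<le> \<bar>c\<bar> * d" using KU by (intro mult_left_mono) auto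
    also have "\<dots> < e" using base by (simp add: d_def field_simps)
    finally show ?case using g bg by blast
  next
    case (add f1 f2)
    from add.IH[of "e / 2"] add.prems obtain g1 g2 where
      g1: "continuous_on UNIV g1" "bounded (range g1)" "(\<integral>x. \<bar>f1 x - g1 x\<bar> \<partial>N) < e / 2" and
      g2: "continuous_on UNIV g2" "bounded (range g2)" "(\<integral>x. \<bar>f2 x - g2 x\<bar> \<partial>N) < e / 2"
      by auto
    define g where "g x = g1 x + g2 x" for x
    have g: "continuous_on UNIV g" "bounded (range g)"
      unfolding g_def using g1 g2 by (auto intro!: continuous_intros bounded_plus_comp)
    have "(\<integral>x. \<bar>f1 x + f2 x - g x\<bar> \<partial>N) \<le> (\<integral>x. \<bar>f1 x - g1 x\<bar> + \<bar>f2 x - g2 x\<bar> \<partial>N)"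
      by (rule integral_mono) (use add cint g1 g2 g in \<open>auto simp: g_def\<close>)
    also have "\<dots> = (\<integral>x. \<bar>f1 x - g1 x\<bar> \<partial>N) + (\<integral>x. \<bar>f2 x - g2 x\<bar> \<partial>N)"
      by (rule Bochner_Integration.integral_add) (use add cint g1 g2 in auto)
    also have "\<dots> < e" using g1 g2 by simp
    finally show ?case using g by blast
  next
    case (lim f s)
    have "(\<lambda>i. \<integral>x. \<bar>f x - s i x\<bar> \<partial>N) \<longlonglongrightarrow> (\<integral>x. 0 \<partial>N)"
    proof (rule integral_dominated_convergence[where w="\<lambda>x. 3 * \<bar>f x\<bar>"])
      show "AE x in N. (\<lambda>i. \<bar>f x - s i x\<bar>) \<longlonglongrightarrow> 0"
      proof (rule AE_I2)
        fix x assume "x \<in> space N"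
        then have "(\<lambda>i. \<bar>f x - s i x\<bar>) \<longlonglongrightarrow> \<bar>f x - f x\<bar>" by (intro tendsto_intros lim.hyps(2))
        then show "(\<lambda>i. \<bar>f x - s i x\<bar>) \<longlonglongrightarrow> 0" by simp
      qed
      \<comment> \<open>The approximants of the induction satisfy
        \<open>\<bar>s i x\<bar> \<le> 2 * \<bar>f x\<bar>\<close>, which explains the factor
        \<open>3\<close>.\<close>
      show "AE x in N. norm \<bar>f x - s i x\<bar> \<le> 3 * \<bar>f x\<bar>" for i
        using lim.hyps(3)[of _ i] by (intro AE_I2) (smt (verit) real_norm_def)
    qed (use lim in auto)
    then have "eventually (\<lambda>i. (\<integral>x. \<bar>f x - s i x\<bar> \<partial>N) < e / 2) sequentially"
      using lim.prems by (intro order_tendstoD) auto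
    then obtain i where i: "(\<integral>x. \<bar>f x - s i x\<bar> \<partial>N) < e / 2" by (auto simp: eventually_sequentially)
    from lim.IH[of "e / 2" i] lim.prems obtain g where
      g: "continuous_on UNIV g" "bounded (range g)" "(\<integral>x. \<bar>s i x - g x\<bar> \<partial>N) < e / 2" by auto
    have "(\<integral>x. \<bar>f x - g x\<bar> \<partial>N) \<le> (\<integral>x. \<bar>f x - s i x\<bar> + \<bar>s i x - g x\<bar> \<partial>N)"
      by (rule integral_mono) (use lim cint g in auto)
    also have "\<dots> = (\<integral>x. \<bar>f x - s i x\<bar> \<partial>N) + (\<integral>x. \<bar>s i x - g x\<bar> \<partial>N)"
      by (rule Bochner_Integration.integral_add) (use lim cint g in auto)
    also have "\<dots> < e" using g i by simp
    finally show ?case using g by blast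
  }
qed

lemma unit_borel_measurable_borel:
  "f \<in> borel_measurable borel \<Longrightarrow> f \<in> borel_measurable unit_borel"
  by (rule measurable_restrict_space1)

lemma prob_measuresD:
  assumes "\<mu> \<in> prob_measures"
  shows "prob_space \<mu>" "sets \<mu> = sets unit_borel" "space \<mu> = {0..1}"
proof -
  show "prob_space \<mu>" and *: "sets \<mu> = sets unit_borel"
    using assms by (auto simp: space_prob_algebra)
  show "space \<mu> = {0..1}" using sets_eq_imp_space_eq[OF *] by (simp add: space_restrict_space)
qed

lemma prob_measures_borel_measurable:
  assumes "\<mu> \<in> prob_measures" "f \<in> borel_measurable borel"
  shows "f \<in> borel_measurable \<mu>"
  using unit_borel_measurable_borel[OF assms(2)] prob_measuresD(2)[OF assms(1)]
  by (simp cong: measurable_cong_sets)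

text \<open>Both measures are dominated by twice their midpoint, so density of continuous functions in
  \<open>L\<^sup>1\<close> of the midpoint gives simultaneous approximation.\<close>

lemma continuous_dense_L1_two:
  fixes F :: "real \<Rightarrow> real"
  assumes \<alpha>: "\<alpha> \<in> prob_measures" and \<beta>: "\<beta> \<in> prob_measures"
    and F: "F \<in> borel_measurable unit_borel" and B: "\<And>x. \<bar>F x\<bar> \<le> B" and "0 < e"
  obtains g where "continuous_on UNIV g" "\<And>x. \<bar>g x\<bar> \<le> B"
    "(\<integral>x. \<bar>F x - g x\<bar> \<partial>\<alpha>) < e" "(\<integral>x. \<bar>F x - g x\<bar> \<partial>\<beta>) < e"
proof -
  interpret \<alpha>: prob_space \<alpha> using \<alpha> by (rule prob_measuresD)
  interpret \<beta>: prob_space \<beta> using \<beta> by (rule prob_measuresD)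
  \<comment> \<open>Extension by zero moves the problem to the whole line, where
    \<open>continuous_dense_L1\<close> lives; on the unit interval \<open>h\<close> and
    \<open>F\<close> agree.\<close>
  define h where "h x = F x * indicator {0..1} x" for x
  have h[measurable]: "h \<in> borel_measurable borel"
    using F unfolding h_def by (subst (asm) borel_measurable_restrict_space_iff) (auto simp: mult.commute)
  have hB: "\<bar>h x\<bar> \<le> B" for x using B[of x] by (auto simp: h_def split: split_indicator)
  have idm: "id \<in> borel_measurable \<alpha>" "id \<in> borel_measurable \<beta>"
    by (rule prob_measures_borel_measurable[OF \<alpha> measurable_ident],
        rule prob_measures_borel_measurable[OF \<beta> measurable_ident])
  define \<kappa> where "\<kappa> c = distr (if c then \<alpha> else \<beta>) borel id" for c
  define N where "N = measure_pmf (bernoulli_pmf (1/2)) \<bind> \<kappa>"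
  have \<kappa>: "\<kappa> \<in> measure_pmf (bernoulli_pmf (1/2)) \<rightarrow>\<^sub>M prob_algebra borel"
    using idm by (auto simp: measurable_def space_prob_algebra \<kappa>_def
      intro!: \<alpha>.prob_space_distr \<beta>.prob_space_distr)
  have N: "prob_space N" "sets N = sets borel"
    unfolding N_def by (intro prob_space_bind'[OF _ \<kappa>] sets_bind'[OF _ \<kappa>];
      simp add: space_prob_algebra measure_pmf.prob_space_axioms)+
  interpret N: prob_space N by fact
  have nn: "(\<integral>\<^sup>+x. f x \<partial>N) = (\<integral>\<^sup>+x. f x \<partial>\<alpha>) / 2 + (\<integral>\<^sup>+x. f x \<partial>\<beta>) / 2"
    if [measurable]: "f \<in> borel_measurable borel" for f
  proof -
    have "(\<integral>\<^sup>+x. f x \<partial>N) = (\<integral>\<^sup>+c. (\<integral>\<^sup>+x. f x \<partial>\<kappa> c) \<partial>measure_pmf (bernoulli_pmf (1/2)))"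
      unfolding N_def by (rule nn_integral_bind[OF that measurable_prob_algebraD[OF \<kappa>]])
    also have "\<dots> = (\<integral>\<^sup>+x. f x \<partial>\<kappa> True) / 2 + (\<integral>\<^sup>+x. f x \<partial>\<kappa> False) / 2"
      by (simp add: divide_ennreal_def inverse_ennreal)
    also have "\<dots> = (\<integral>\<^sup>+x. f x \<partial>\<alpha>) / 2 + (\<integral>\<^sup>+x. f x \<partial>\<beta>) / 2"
      using idm by (simp add: \<kappa>_def nn_integral_distr)
    finally show ?thesis .
  qed
  have "integrable N h"
    using hB by (intro N.integrable_const_bound[where B=B]) (auto simp: measurable_cong_sets[OF N(2) refl])
  then obtain g0 where g0: "continuous_on UNIV g0" "bounded (range g0)" "(\<integral>x. \<bar>h x - g0 x\<bar> \<partial>N) < e / 2"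
    using continuous_dense_L1[OF N.finite_measure_axioms N(2), of h "e / 2"] \<open>0 < e\<close> by auto
  \<comment> \<open>Since \<open>h\<close> takes values in \<open>[-B, B]\<close>, projecting
    \<open>g0\<close> onto this interval does not increase the distance to \<open>h\<close>. The
    bound \<open>B\<close> on \<open>g\<close> is what later gives \<open>exp\<close> a uniform
    Lipschitz constant.\<close>
  define g where "g x = max (- B) (min B (g0 x))" for x
  have g: "continuous_on UNIV g" unfolding g_def by (intro continuous_intros g0)
  then have gm[measurable]: "g \<in> borel_measurable borel" by (rule borel_measurable_continuous_onI)
  have [measurable]: "g0 \<in> borel_measurable borel" using g0(1) by (rule borel_measurable_continuous_onI)
  have B0: "0 \<le> B" using B[of 0] by simp
  have gB: "\<bar>g x\<bar> \<le> B" for x using B0 by (auto simp: g_def)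
  have gl: "\<bar>h x - g x\<bar> \<le> \<bar>h x - g0 x\<bar>" for x using hB[of x] by (auto simp: g_def)
  obtain B' where B': "\<And>x. \<bar>g0 x\<bar> \<le> B'" using g0(2) by (auto simp: bounded_iff)
  have i0: "integrable N (\<lambda>x. \<bar>h x - g0 x\<bar>)"
  proof (rule N.integrable_const_bound[where B="B + B'"])
    show "AE x in N. norm \<bar>h x - g0 x\<bar> \<le> B + B'"
      using hB B' by (intro AE_I2) (smt (verit) real_norm_def)
  qed (auto simp: measurable_cong_sets[OF N(2) refl])
  have "(\<integral>\<^sup>+x. ennreal \<bar>h x - g x\<bar> \<partial>N) \<le> (\<integral>\<^sup>+x. ennreal \<bar>h x - g0 x\<bar> \<partial>N)"
    by (intro nn_integral_mono ennreal_leI gl)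
  also have "\<dots> = ennreal (\<integral>x. \<bar>h x - g0 x\<bar> \<partial>N)" by (rule nn_integral_eq_integral[OF i0]) auto
  also have "\<dots> < ennreal (e / 2)" using g0(3) \<open>0 < e\<close> by (intro ennreal_lessI) auto
  finally have lt: "(\<integral>\<^sup>+x. ennreal \<bar>h x - g x\<bar> \<partial>N) < ennreal (e / 2)" .
  have fin: "(\<integral>x. \<bar>F x - g x\<bar> \<partial>\<gamma>) < e"
    if \<gamma>: "\<gamma> \<in> prob_measures" and le: "(\<integral>\<^sup>+x. ennreal \<bar>h x - g x\<bar> \<partial>\<gamma>) / 2 \<le> (\<integral>\<^sup>+x. ennreal \<bar>h x - g x\<bar> \<partial>N)" for \<gamma>
  proof -
    interpret \<gamma>: prob_space \<gamma> using \<gamma> by (rule prob_measuresD)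
    have hm: "h \<in> borel_measurable \<gamma>" "g \<in> borel_measurable \<gamma>"
      by (rule prob_measures_borel_measurable[OF \<gamma> h], rule prob_measures_borel_measurable[OF \<gamma> gm])
    have i: "integrable \<gamma> (\<lambda>x. \<bar>h x - g x\<bar>)"
    proof (rule \<gamma>.integrable_const_bound[where B="B + B"])
      show "AE x in \<gamma>. norm \<bar>h x - g x\<bar> \<le> B + B"
        using hB gB by (intro AE_I2) (smt (verit) real_norm_def)
    qed (use hm in measurable)
    have "ennreal ((\<integral>x. \<bar>h x - g x\<bar> \<partial>\<gamma>) / 2) = (\<integral>\<^sup>+x. ennreal \<bar>h x - g x\<bar> \<partial>\<gamma>) / 2"
      by (simp add: nn_integral_eq_integral[OF i] ennreal_divide_numeral)
    also have "\<dots> < ennreal (e / 2)" using le lt by (rule order.strict_trans1)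
    finally have "(\<integral>x. \<bar>h x - g x\<bar> \<partial>\<gamma>) < e"
      by (simp add: ennreal_less_iff)
    moreover have "(\<integral>x. \<bar>h x - g x\<bar> \<partial>\<gamma>) = (\<integral>x. \<bar>F x - g x\<bar> \<partial>\<gamma>)"
      by (rule Bochner_Integration.integral_cong) (auto simp: h_def prob_measuresD(3)[OF \<gamma>])
    ultimately show ?thesis by simp
  qed
  have "(\<integral>x. \<bar>F x - g x\<bar> \<partial>\<alpha>) < e" "(\<integral>x. \<bar>F x - g x\<bar> \<partial>\<beta>) < e"
    by (intro fin \<alpha> \<beta>; simp add: nn)+
  with that g gB show thesis by blast
qed

text \<open>On \<open>[-B, B]\<close> the exponential has Lipschitz constant \<open>exp B\<close>,
  so approximation in \<open>L1\<close> under both measures moves the variational expression only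
  slightly, and a bound on continuous test functions extends to measurable ones. The factor
  \<open>ln 2\<close> appears because \<open>KL\<close> is in bits.\<close>

lemma KL_le_of_continuous_bound:
  assumes \<alpha>: "\<alpha> \<in> prob_measures" and \<beta>: "\<beta> \<in> prob_measures"
    and bound: "\<And>f B. continuous_on UNIV f \<Longrightarrow> (\<And>x. \<bar>f x\<bar> \<le> B) \<Longrightarrow>
       (\<integral>x. f x \<partial>\<alpha>) - (\<integral>x. exp (f x) \<partial>\<beta>) + 1 \<le> C * ln 2"
  shows "KL \<alpha> \<beta> \<le> ereal C"
proof -
  note a = prob_measuresD[OF \<alpha>] and b = prob_measuresD[OF \<beta>]
  have sets: "sets \<alpha> = sets \<beta>" by (simp add: a b)
  interpret \<alpha>: prob_space \<alpha> by (rule a)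
  interpret \<beta>: prob_space \<beta> by (rule b)
  have key: "(\<integral>x. F x \<partial>\<alpha>) - (\<integral>x. exp (F x) \<partial>\<beta>) + 1 \<le> C * ln 2"
    if F': "F \<in> borel_measurable \<beta>" and B: "\<And>x. \<bar>F x\<bar> \<le> B" for F B
  proof (rule field_le_epsilon)
    fix e :: real assume "0 < e"
    \<comment> \<open>The linear term contributes an error \<open>d\<close> and the exponential term
      \<open>exp B * d\<close>; together they make \<open>e\<close>.\<close>
    define d where "d = e / (1 + exp B)"
    have dpos: "0 < d" using \<open>0 < e\<close> by (simp add: d_def add_pos_pos)
    have F: "F \<in> borel_measurable unit_borel" using F' b(2) by (simp cong: measurable_cong_sets)
    obtain g where g: "continuous_on UNIV g" "\<And>x. \<bar>g x\<bar> \<le> B"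
      "(\<integral>x. \<bar>F x - g x\<bar> \<partial>\<alpha>) < d" "(\<integral>x. \<bar>F x - g x\<bar> \<partial>\<beta>) < d"
      using continuous_dense_L1_two[OF \<alpha> \<beta> F B dpos] by blast
    have gm: "g \<in> borel_measurable borel" using g(1) by (rule borel_measurable_continuous_onI)
    have gu: "g \<in> borel_measurable unit_borel" using gm by (rule unit_borel_measurable_borel)
    have bi: "integrable \<gamma> F" "integrable \<gamma> g" "integrable \<gamma> (\<lambda>x. exp (F x))" "integrable \<gamma> (\<lambda>x. exp (g x))"
      if "finite_measure \<gamma>" "sets \<gamma> = sets unit_borel" for \<gamma>
      by (rule bounded_measurable_integrable[OF that F B] bounded_measurable_integrable[OF that gu g(2)]
        exp_bounded_measurable_integrable[OF that F B] exp_bounded_measurable_integrable[OF that gu g(2)])+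
    note ia = bi[OF \<alpha>.finite_measure_axioms a(2)] and ib = bi[OF \<beta>.finite_measure_axioms b(2)]
    have "(\<integral>x. F x \<partial>\<alpha>) - (\<integral>x. g x \<partial>\<alpha>) = (\<integral>x. F x - g x \<partial>\<alpha>)"
      using ia by simp
    also have "\<dots> \<le> (\<integral>x. \<bar>F x - g x\<bar> \<partial>\<alpha>)" by (rule integral_mono) (use ia in auto)
    finally have 1: "(\<integral>x. F x \<partial>\<alpha>) - (\<integral>x. g x \<partial>\<alpha>) \<le> d" using g(3) by simp
    have el: "exp (g x) - exp (F x) \<le> exp B * \<bar>F x - g x\<bar>" for x
    proof -
      have "exp (g x) * (1 + (F x - g x)) \<le> exp (g x) * exp (F x - g x)"
        by (intro mult_left_mono exp_ge_add_one_self) auto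
      also have "\<dots> = exp (F x)" by (simp flip: exp_add)
      finally have "exp (g x) - exp (F x) \<le> exp (g x) * (g x - F x)" by (simp add: algebra_simps)
      also have "\<dots> \<le> exp B * \<bar>F x - g x\<bar>"
        using g(2)[of x] by (intro order.trans[OF mult_left_mono mult_right_mono]) auto
      finally show ?thesis .
    qed
    have "(\<integral>x. exp (g x) \<partial>\<beta>) - (\<integral>x. exp (F x) \<partial>\<beta>) = (\<integral>x. exp (g x) - exp (F x) \<partial>\<beta>)"
      using ib by simp
    also have "\<dots> \<le> (\<integral>x. exp B * \<bar>F x - g x\<bar> \<partial>\<beta>)"
      by (rule integral_mono[OF _ _ el]) (use ib in auto)
    also have "\<dots> = exp B * (\<integral>x. \<bar>F x - g x\<bar> \<partial>\<beta>)" by simp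
    also have "\<dots> \<le> exp B * d" using g(4) by (intro mult_left_mono) auto
    finally have 2: "(\<integral>x. exp (g x) \<partial>\<beta>) - (\<integral>x. exp (F x) \<partial>\<beta>) \<le> exp B * d" .
    have "(1 + exp B) * d = e" unfolding d_def by (simp add: add_pos_pos less_imp_neq[symmetric])
    then have "d + exp B * d = e" by (simp add: algebra_simps)
    then show "(\<integral>x. F x \<partial>\<alpha>) - (\<integral>x. exp (F x) \<partial>\<beta>) + 1 \<le> C * ln 2 + e"
      using 1 2 bound[OF g(1,2)] by linarith
  qed
  note U = KL_divergence_variational_upper[OF b(1) a(1) sets, where b=2 and C="C * ln 2"]
  have "absolutely_continuous \<beta> \<alpha>" by (rule U(1)) (simp, rule key)
  moreover have "integrable \<alpha> (entropy_density 2 \<beta> \<alpha>)" by (rule U(2)) (simp, rule key)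
  moreover have "ln 2 * KL_divergence 2 \<beta> \<alpha> \<le> C * ln 2" by (rule U(3)) (simp, rule key)
  ultimately show ?thesis by (simp add: KL_def)
qed

section \<open>Weak convergence on the unit interval\<close>

text \<open>Weak convergence on the unit interval, in the form delivered by Skorohod's theorem.\<close>

definition unit_weak_conv :: "(nat \<Rightarrow> real measure) \<Rightarrow> real measure \<Rightarrow> bool" where
  "unit_weak_conv \<mu> \<alpha> \<longleftrightarrow> (\<exists>(\<Omega> :: real measure) Y Y0. prob_space \<Omega> \<and>
     (\<forall>n. Y n \<in> \<Omega> \<rightarrow>\<^sub>M unit_borel) \<and> Y0 \<in> \<Omega> \<rightarrow>\<^sub>M unit_borel \<and>
     (\<forall>n. distr \<Omega> unit_borel (Y n) = \<mu> n) \<and> distr \<Omega> unit_borel Y0 = \<alpha> \<and>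
     (\<forall>x\<in>space \<Omega>. (\<lambda>n. Y n x) \<longlonglongrightarrow> Y0 x))"

lemma unit_weak_convE:
  assumes "unit_weak_conv \<mu> \<alpha>"
  obtains \<Omega> :: "real measure" and Y Y0 where "prob_space \<Omega>"
    "\<And>n. Y n \<in> \<Omega> \<rightarrow>\<^sub>M unit_borel" "Y0 \<in> \<Omega> \<rightarrow>\<^sub>M unit_borel"
    "\<And>n. distr \<Omega> unit_borel (Y n) = \<mu> n" "distr \<Omega> unit_borel Y0 = \<alpha>"
    "\<And>x. x \<in> space \<Omega> \<Longrightarrow> (\<lambda>n. Y n x) \<longlonglongrightarrow> Y0 x"
  using assms unfolding unit_weak_conv_def by blast

lemma unit_weak_conv_prob_measures:
  assumes "unit_weak_conv \<mu> \<alpha>" shows "\<alpha> \<in> prob_measures"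
proof -
  from assms obtain \<Omega> :: "real measure" and Y0 where
    "prob_space \<Omega>" "Y0 \<in> \<Omega> \<rightarrow>\<^sub>M unit_borel" "distr \<Omega> unit_borel Y0 = \<alpha>"
    by (rule unit_weak_convE)
  then show ?thesis by (auto simp: space_prob_algebra intro!: prob_space.prob_space_distr)
qed

lemma unit_weak_conv_subseq:
  assumes "unit_weak_conv \<mu> \<alpha>" "strict_mono r" shows "unit_weak_conv (\<mu> \<circ> r) \<alpha>"
proof -
  from assms(1) obtain \<Omega> :: "real measure" and Y Y0 where *: "prob_space \<Omega>"
    "\<And>n. Y n \<in> \<Omega> \<rightarrow>\<^sub>M unit_borel" "Y0 \<in> \<Omega> \<rightarrow>\<^sub>M unit_borel"
    "\<And>n. distr \<Omega> unit_borel (Y n) = \<mu> n" "distr \<Omega> unit_borel Y0 = \<alpha>"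
    "\<And>x. x \<in> space \<Omega> \<Longrightarrow> (\<lambda>n. Y n x) \<longlonglongrightarrow> Y0 x"
    by (rule unit_weak_convE) blast
  show ?thesis unfolding unit_weak_conv_def
    by (intro exI[of _ \<Omega>] exI[of _ "\<lambda>n. Y (r n)"] exI[of _ Y0])
       (use * LIMSEQ_subseq_LIMSEQ[OF *(6) assms(2)] in \<open>auto simp: o_def\<close>)
qed

text \<open>Tightness is automatic for laws on a bounded interval, so a subsequence converges weakly
  on the line. Skorohod's theorem then supplies pointwise convergent variables, which remain to be
  brought back into the unit interval.\<close>

lemma unit_measures_weakly_compact:
  fixes \<mu> :: "nat \<Rightarrow> real measure"
  assumes \<mu>: "\<And>n. \<mu> n \<in> prob_measures"
  obtains r \<alpha> where "strict_mono r" "unit_weak_conv (\<mu> \<circ> r) \<alpha>"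
proof -
  note m = prob_measuresD[OF \<mu>]
  define \<nu> where "\<nu> n = distr (\<mu> n) borel id" for n
  have idm: "id \<in> \<mu> n \<rightarrow>\<^sub>M borel" for n
    using measurable_restrict_space1[OF measurable_ident, of borel "{0..1}"]
      measurable_cong_sets[OF m(2) refl] by blast
  have rd: "real_distribution (\<nu> n)" for n
    unfolding real_distribution_def real_distribution_axioms_def \<nu>_def
    using prob_space.prob_space_distr[OF m(1) idm] by simp
  \<comment> \<open>Tightness speaks of half-open intervals; a left end below \<open>0\<close>
    catches a possible atom at \<open>0\<close>.\<close>
  have full: "measure (\<nu> n) {-1<..1} = 1" for n
  proof -
    interpret prob_space "\<mu> n" by (rule m)
    have "measure (\<nu> n) {-1<..1} = measure (\<mu> n) (space (\<mu> n))"
      unfolding \<nu>_def using idm m(3)[of n] by (subst measure_distr) (auto intro!: arg_cong[where f="measure (\<mu> n)"])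
    then show ?thesis by (simp add: prob_space)
  qed
  have "tight \<nu>" unfolding tight_def
  proof (intro conjI allI impI)
    fix e :: real assume "0 < e"
    then show "\<exists>a b. a < b \<and> (\<forall>n. 1 - e < measure (\<nu> n) {a<..b})"
      using full by (intro exI[of _ "-1"] exI[of _ 1]) auto
  qed (rule rd)
  from tight_imp_convergent_subsubsequence[OF this strict_mono_id] obtain r N where
    r: "strict_mono r" and N: "real_distribution N" and conv: "weak_conv_m (\<lambda>n. \<nu> (r n)) N"
    by (auto simp: o_def)
  from Skorohod[OF rd N conv] obtain \<Omega> :: "real measure" and Y :: "nat \<Rightarrow> real \<Rightarrow> real" and Y0 :: "real \<Rightarrow> real"
    where \<Omega>: "prob_space \<Omega>" and Y[measurable]: "\<And>n. Y n \<in> \<Omega> \<rightarrow>\<^sub>M borel"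
      and dY: "\<And>n. distr \<Omega> borel (Y n) = \<nu> (r n)" and Y0: "Y0 \<in> \<Omega> \<rightarrow>\<^sub>M lborel"
      and lim: "\<And>x. x \<in> space \<Omega> \<Longrightarrow> (\<lambda>n. Y n x) \<longlonglongrightarrow> Y0 x"
    by metis
  have [measurable]: "Y0 \<in> \<Omega> \<rightarrow>\<^sub>M borel" using Y0 by simp
  \<comment> \<open>The variables from Skorohod's theorem are real-valued and may leave the unit
    interval on a null set. Clamping is continuous, hence keeps the limits, and is the identity on
    the interval, hence keeps the laws \<open>\<mu> (r n)\<close>.\<close>
  define c where "c x = max 0 (min 1 x)" for x :: real
  have c[measurable]: "c \<in> borel \<rightarrow>\<^sub>M unit_borel"
    unfolding c_def by (rule measurable_restrict_space2) auto
  have dc: "distr \<Omega> unit_borel (\<lambda>x. c (Y n x)) = \<mu> (r n)" for n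
  proof -
    have "distr \<Omega> unit_borel (\<lambda>x. c (Y n x)) = distr (distr \<Omega> borel (Y n)) unit_borel c"
      by (simp add: distr_distr[OF c Y] o_def)
    also have "\<dots> = distr (\<mu> (r n)) unit_borel (\<lambda>x. c (id x))"
      unfolding dY \<nu>_def by (simp add: distr_distr[OF c idm] o_def)
    also have "\<dots> = distr (\<mu> (r n)) (\<mu> (r n)) (\<lambda>x. x)"
      by (rule distr_cong) (auto simp: m c_def)
    finally show ?thesis by simp
  qed
  have "unit_weak_conv (\<mu> \<circ> r) (distr \<Omega> unit_borel (\<lambda>x. c (Y0 x)))"
    unfolding unit_weak_conv_def
  proof (intro exI[of _ \<Omega>] exI[of _ "\<lambda>n x. c (Y n x)"] exI[of _ "\<lambda>x. c (Y0 x)"] conjI allI ballI)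
    show "(\<lambda>n. c (Y n x)) \<longlonglongrightarrow> c (Y0 x)" if "x \<in> space \<Omega>" for x
      unfolding c_def by (intro tendsto_intros lim that)
  qed (use \<Omega> dc in \<open>auto intro: measurable_compose[OF _ c]\<close>)
  with r that show thesis by blast
qed

text \<open>The joint law of \<open>Y n\<close> and \<open>Y0\<close> is an admissible coupling with
  cost the mean of \<open>\<bar>Y n - Y0\<bar>\<close>. This distance is at most \<open>1\<close>
  and tends to \<open>0\<close> pointwise, so bounded convergence applies.\<close>

lemma wasserstein1_tendsto_0:
  assumes "unit_weak_conv \<mu> \<alpha>"
  shows "(\<lambda>n. wasserstein1 (\<mu> n) \<alpha>) \<longlonglongrightarrow> 0"
proof -
  from assms obtain \<Omega> :: "real measure" and Y Y0 where \<Omega>: "prob_space \<Omega>"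
    and Y[measurable]: "\<And>n. Y n \<in> \<Omega> \<rightarrow>\<^sub>M unit_borel" and Y0[measurable]: "Y0 \<in> \<Omega> \<rightarrow>\<^sub>M unit_borel"
    and dY: "\<And>n. distr \<Omega> unit_borel (Y n) = \<mu> n" "distr \<Omega> unit_borel Y0 = \<alpha>"
    and lim: "\<And>x. x \<in> space \<Omega> \<Longrightarrow> (\<lambda>n. Y n x) \<longlonglongrightarrow> Y0 x"
    by (rule unit_weak_convE) blast
  interpret prob_space \<Omega> by fact
  have Yb[measurable]: "Y n \<in> borel_measurable \<Omega>" "Y0 \<in> borel_measurable \<Omega>" for n
    using Y Y0 by (auto simp: measurable_restrict_space2_iff)
  have Y01: "Y n x \<in> {0..1}" "Y0 x \<in> {0..1}" if "x \<in> space \<Omega>" for n x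
    using measurable_space[OF Y that] measurable_space[OF Y0 that] by (auto simp: space_restrict_space)
  have diff: "\<bar>Y n x - Y0 x\<bar> \<le> 1" if "x \<in> space \<Omega>" for n x
    using Y01(1)[OF that, of n] Y01(2)[OF that] by auto
  have le: "wasserstein1 (\<mu> n) \<alpha> \<le> ennreal (\<integral>x. \<bar>Y n x - Y0 x\<bar> \<partial>\<Omega>)" for n
  proof -
    define \<gamma> where "\<gamma> = distr \<Omega> (unit_borel \<Otimes>\<^sub>M unit_borel) (\<lambda>x. (Y n x, Y0 x))"
    have pm: "(\<lambda>x. (Y n x, Y0 x)) \<in> \<Omega> \<rightarrow>\<^sub>M unit_borel \<Otimes>\<^sub>M unit_borel" by measurable
    have "\<gamma> \<in> couplings (\<mu> n) \<alpha>"
      unfolding couplings_def \<gamma>_def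
      using prob_space_distr[OF pm] dY
      by (auto simp: space_prob_algebra distr_distr[OF measurable_fst pm] distr_distr[OF measurable_snd pm] o_def)
    then have "wasserstein1 (\<mu> n) \<alpha> \<le> (\<integral>\<^sup>+ p. ennreal \<bar>fst p - snd p\<bar> \<partial>\<gamma>)"
      unfolding wasserstein1_def by (rule INF_lower)
    also have "\<dots> = (\<integral>\<^sup>+ x. ennreal \<bar>Y n x - Y0 x\<bar> \<partial>\<Omega>)"
    proof -
      have "(\<lambda>x::real. x) \<in> borel_measurable unit_borel"
        by (rule measurable_restrict_space1) simp
      then have [measurable]: "fst \<in> borel_measurable (unit_borel \<Otimes>\<^sub>M unit_borel)"
        "snd \<in> borel_measurable (unit_borel \<Otimes>\<^sub>M unit_borel)"
        using measurable_compose[OF measurable_fst] measurable_compose[OF measurable_snd] by blast+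
      show ?thesis unfolding \<gamma>_def by (subst nn_integral_distr[OF pm]) auto
    qed
    also have "\<dots> = ennreal (\<integral>x. \<bar>Y n x - Y0 x\<bar> \<partial>\<Omega>)"
    proof (rule nn_integral_eq_integral)
      show "integrable \<Omega> (\<lambda>x. \<bar>Y n x - Y0 x\<bar>)"
        by (rule integrable_const_bound[where B=1]) (use diff in auto)
    qed auto
    finally show ?thesis .
  qed
  have "(\<lambda>n. \<integral>x. \<bar>Y n x - Y0 x\<bar> \<partial>\<Omega>) \<longlonglongrightarrow> (\<integral>x. 0 \<partial>\<Omega>)"
  proof (rule integral_dominated_convergence[where w="\<lambda>x. 1"])
    show "AE x in \<Omega>. (\<lambda>n. \<bar>Y n x - Y0 x\<bar>) \<longlonglongrightarrow> 0"
    proof (rule AE_I2)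
      fix x assume "x \<in> space \<Omega>"
      then have "(\<lambda>n. \<bar>Y n x - Y0 x\<bar>) \<longlonglongrightarrow> \<bar>Y0 x - Y0 x\<bar>" by (intro tendsto_intros lim)
      then show "(\<lambda>n. \<bar>Y n x - Y0 x\<bar>) \<longlonglongrightarrow> 0" by simp
    qed
    show "AE x in \<Omega>. norm \<bar>Y n x - Y0 x\<bar> \<le> 1" for n
      using diff by (intro AE_I2) auto
  qed auto
  then have "(\<lambda>n. ennreal (\<integral>x. \<bar>Y n x - Y0 x\<bar> \<partial>\<Omega>)) \<longlonglongrightarrow> 0"
    using tendsto_ennrealI by fastforce
  from tendsto_sandwich[OF _ _ tendsto_const this, of "\<lambda>n. wasserstein1 (\<mu> n) \<alpha>"] le
  show ?thesis by simp
qed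

lemma integral_tendsto_of_unit_weak_conv:
  fixes f :: "real \<Rightarrow> real"
  assumes "unit_weak_conv \<mu> \<alpha>" and f: "continuous_on UNIV f" "\<And>x. \<bar>f x\<bar> \<le> B"
  shows "(\<lambda>n. \<integral>x. f x \<partial>\<mu> n) \<longlonglongrightarrow> (\<integral>x. f x \<partial>\<alpha>)"
proof -
  from assms(1) obtain \<Omega> :: "real measure" and Y Y0 where \<Omega>: "prob_space \<Omega>"
    and Y[measurable]: "\<And>n. Y n \<in> \<Omega> \<rightarrow>\<^sub>M unit_borel" and Y0[measurable]: "Y0 \<in> \<Omega> \<rightarrow>\<^sub>M unit_borel"
    and dY: "\<And>n. distr \<Omega> unit_borel (Y n) = \<mu> n" "distr \<Omega> unit_borel Y0 = \<alpha>"
    and lim: "\<And>x. x \<in> space \<Omega> \<Longrightarrow> (\<lambda>n. Y n x) \<longlonglongrightarrow> Y0 x"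
    by (rule unit_weak_convE) blast
  interpret prob_space \<Omega> by fact
  have fm: "f \<in> borel_measurable unit_borel"
    by (rule measurable_restrict_space1[OF borel_measurable_continuous_onI[OF f(1)]])
  have "(\<lambda>n. \<integral>x. f (Y n x) \<partial>\<Omega>) \<longlonglongrightarrow> (\<integral>x. f (Y0 x) \<partial>\<Omega>)"
  proof (rule integral_dominated_convergence[where w="\<lambda>x. B"])
    show "AE x in \<Omega>. (\<lambda>n. f (Y n x)) \<longlonglongrightarrow> f (Y0 x)"
      using f(1) lim by (intro AE_I2) (auto intro!: isCont_tendsto_compose[where g=f] simp: continuous_on_eq_continuous_at)
  qed (use f(2) in \<open>auto intro: measurable_compose[OF _ fm]\<close>)
  moreover have "(\<integral>x. f x \<partial>\<mu> n) = (\<integral>x. f (Y n x) \<partial>\<Omega>)" for n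
    unfolding dY[symmetric] by (rule integral_distr[OF Y fm])
  moreover have "(\<integral>x. f x \<partial>\<alpha>) = (\<integral>x. f (Y0 x) \<partial>\<Omega>)"
    unfolding dY[symmetric] by (rule integral_distr[OF Y0 fm])
  ultimately show ?thesis by simp
qed

section \<open>Lower semicontinuity of the error functionals\<close>

lemma lower_semicontinuous_unit_measurable:
  assumes "lower_semicontinuous_unit d"
  shows "d \<in> borel_measurable unit_borel"
proof (rule borel_measurableI_greater)
  fix a
  have "openin (top_of_set {0..1}) {x \<in> {0..1}. a < d x}"
    unfolding openin_subopen[of _ "{x \<in> {0..1}. a < d x}"]
  proof
    fix x assume x: "x \<in> {x \<in> {0..1}. a < d x}"
    then have "eventually (\<lambda>z. a < d z) (at x within {0..1})"
      using assms unfolding lower_semicontinuous_unit_def by blast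
    then obtain S where S: "open S" "x \<in> S" "\<And>y. y \<in> S \<Longrightarrow> y \<noteq> x \<Longrightarrow> y \<in> {0..1} \<Longrightarrow> a < d y"
      unfolding eventually_at_topological by blast
    then have "{0..1} \<inter> S \<subseteq> {x \<in> {0..1}. a < d x}" using x by blast
    with S(1,2) show "\<exists>T. openin (top_of_set {0..1}) T \<and> x \<in> T \<and> T \<subseteq> {x \<in> {0..1}. a < d x}"
      using x by (intro exI[of _ "{0..1} \<inter> S"]) (auto intro: openin_open_Int)
  qed
  then obtain T where "open T" "{x \<in> {0..1}. a < d x} = {0..1} \<inter> T" by (auto simp: openin_open)
  then show "{x \<in> space unit_borel. a < d x} \<in> sets unit_borel"
    by (auto simp: space_restrict_space sets_restrict_space)
qed

lemma lower_semicontinuous_unit_liminf: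
  assumes d: "lower_semicontinuous_unit d" and x: "x \<in> {0..1}" "\<And>n. y n \<in> {0..1}" "y \<longlonglongrightarrow> x"
  shows "d x \<le> liminf (\<lambda>n. d (y n))"
  unfolding le_Liminf_iff
proof (intro allI impI)
  fix a assume a: "a < d x"
  then have "eventually (\<lambda>z. a < d z) (at x within {0..1})"
    using d x unfolding lower_semicontinuous_unit_def by blast
  \<comment> \<open>The filter \<open>at x within\<close> omits \<open>x\<close>, but the sequence
    may hit \<open>x\<close>; there the inequality is the assumption \<open>a < d x\<close>.\<close>
  then have "eventually (\<lambda>z. z \<in> {0..1} \<longrightarrow> a < d z) (nhds x)"
    unfolding eventually_at_filter by eventually_elim (use a in auto)
  with x(3) have "eventually (\<lambda>n. y n \<in> {0..1} \<longrightarrow> a < d (y n)) sequentially"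
    unfolding filterlim_iff by blast
  then show "eventually (\<lambda>n. a < d (y n)) sequentially" using x(2) by simp
qed

text \<open>Transported to \<open>\<Omega>\<close>, this is pointwise lower semicontinuity followed
  by Fatou's lemma. Nonnegativity suffices, so infinite values of \<open>d\<close> do no
  harm.\<close>

lemma nn_integral_liminf_of_unit_weak_conv:
  assumes "unit_weak_conv \<mu> \<alpha>" and d: "lower_semicontinuous_unit d"
  shows "(\<integral>\<^sup>+x. d x \<partial>\<alpha>) \<le> liminf (\<lambda>n. \<integral>\<^sup>+x. d x \<partial>\<mu> n)"
proof -
  from assms(1) obtain \<Omega> :: "real measure" and Y Y0 where \<Omega>: "prob_space \<Omega>"
    and Y[measurable]: "\<And>n. Y n \<in> \<Omega> \<rightarrow>\<^sub>M unit_borel" and Y0[measurable]: "Y0 \<in> \<Omega> \<rightarrow>\<^sub>M unit_borel"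
    and dY: "\<And>n. distr \<Omega> unit_borel (Y n) = \<mu> n" "distr \<Omega> unit_borel Y0 = \<alpha>"
    and lim: "\<And>x. x \<in> space \<Omega> \<Longrightarrow> (\<lambda>n. Y n x) \<longlonglongrightarrow> Y0 x"
    by (rule unit_weak_convE) blast
  have dm: "d \<in> borel_measurable unit_borel" using d by (rule lower_semicontinuous_unit_measurable)
  have Y01: "Y n x \<in> {0..1}" "Y0 x \<in> {0..1}" if "x \<in> space \<Omega>" for n x
    using measurable_space[OF Y that] measurable_space[OF Y0 that] by (auto simp: space_restrict_space)
  have "(\<integral>\<^sup>+x. d x \<partial>\<alpha>) = (\<integral>\<^sup>+x. d (Y0 x) \<partial>\<Omega>)"
    unfolding dY[symmetric] by (rule nn_integral_distr[OF Y0]) (simp add: dm)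
  also have "\<dots> \<le> (\<integral>\<^sup>+x. liminf (\<lambda>n. d (Y n x)) \<partial>\<Omega>)"
    by (intro nn_integral_mono lower_semicontinuous_unit_liminf[OF d] Y01 lim)
  also have "\<dots> \<le> liminf (\<lambda>n. \<integral>\<^sup>+x. d (Y n x) \<partial>\<Omega>)"
    by (rule nn_integral_liminf) (rule measurable_compose[OF Y dm])
  also have "(\<lambda>n. \<integral>\<^sup>+x. d (Y n x) \<partial>\<Omega>) = (\<lambda>n. \<integral>\<^sup>+x. d x \<partial>\<mu> n)"
    unfolding dY[symmetric] by (simp add: nn_integral_distr[OF Y] dm)
  finally show ?thesis .
qed

section \<open>A lower bound for the memory budget\<close>

lemma power_add_Suc_ge:
  fixes S a :: real
  assumes "0 \<le> S" "0 \<le> a"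
  shows "S ^ Suc m + real (Suc m) * a * S ^ m \<le> (S + a) ^ Suc m"
proof (induction m)
  case (Suc m)
  have "S ^ Suc (Suc m) + real (Suc (Suc m)) * a * S ^ Suc m
      \<le> (S + a) * (S ^ Suc m + real (Suc m) * a * S ^ m)"
    using assms by (simp add: algebra_simps)
  also have "\<dots> \<le> (S + a) * (S + a) ^ Suc m"
    using assms by (intro mult_left_mono Suc.IH) auto
  finally show ?case by simp
qed simp

lemma subsets_card_Suc_insert:
  assumes "x \<notin> A" "finite A"
  shows "{K. K \<subseteq> insert x A \<and> card K = Suc m} =
    {K. K \<subseteq> A \<and> card K = Suc m} \<union> insert x ` {K. K \<subseteq> A \<and> card K = m}" (is "?L = ?product_law")
proof (intro equalityI subsetI)
  fix K assume K: "K \<in> ?L"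
  show "K \<in> ?product_law"
  proof (cases "x \<in> K")
    case True
    then have "K = insert x (K - {x})" "K - {x} \<subseteq> A" "card (K - {x}) = m" using K by auto
    then show ?thesis by blast
  qed (use K in auto)
next
  fix K assume "K \<in> ?product_law"
  moreover have "card (insert x L) = Suc (card L)" if "L \<subseteq> A" for L
    using assms that by (subst card_insert_disjoint) (auto intro: finite_subset)
  ultimately show "K \<in> ?L" by auto
qed

text \<open>In the expansion of the \<open>m\<close>-th power every product of \<open>m\<close>
  distinct factors occurs \<open>fact m\<close> times, and all other terms are nonnegative. The
  induction splits subsets by whether they contain \<open>x\<close>; the step is closed by the first
  two terms of the binomial expansion, \<open>power_add_Suc_ge\<close>.\<close>

lemma elementary_symmetric_le:
  fixes a :: "'a \<Rightarrow> real"
  assumes "finite A" "\<And>i. i \<in> A \<Longrightarrow> 0 \<le> a i"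
  shows "(\<Sum>K | K \<subseteq> A \<and> card K = m. \<Prod>i\<in>K. a i) \<le> (\<Sum>i\<in>A. a i) ^ m / fact m"
  using assms
proof (induction A arbitrary: m rule: finite_induct)
  case empty
  have "{K. K \<subseteq> {} \<and> card K = m} = (if m = 0 then {{}} else {} :: 'a set set)" by auto
  then show ?case by (simp only:) simp
next
  case (insert x A)
  have fin: "finite {K. K \<subseteq> A \<and> card K = k}" for k using insert.hyps(1) by simp
  have IH: "(\<Sum>K | K \<subseteq> A \<and> card K = k. \<Prod>i\<in>K. a i) \<le> (\<Sum>i\<in>A. a i) ^ k / fact k" for k
    using insert by auto
  define S where "S = (\<Sum>i\<in>A. a i)"
  have S: "0 \<le> S" "0 \<le> a x" unfolding S_def using insert.prems by (auto intro: sum_nonneg)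
  show ?case
  proof (cases m)
    case 0
    have "{K. K \<subseteq> insert x A \<and> card K = 0} = {{}}"
      using insert.hyps(1) by (auto dest: finite_subset)
    then show ?thesis by (simp add: 0)
  next
    case (Suc k)
    have inj: "inj_on (insert x) {K. K \<subseteq> A \<and> card K = k}"
      using insert.hyps(2) by (intro inj_onI) (metis (mono_tags, lifting) insert_ident mem_Collect_eq subsetD)
    have "(\<Sum>K | K \<subseteq> insert x A \<and> card K = m. \<Prod>i\<in>K. a i) =
        (\<Sum>K | K \<subseteq> A \<and> card K = Suc k. \<Prod>i\<in>K. a i)
        + (\<Sum>K\<in>insert x ` {K. K \<subseteq> A \<and> card K = k}. \<Prod>i\<in>K. a i)"
      unfolding Suc subsets_card_Suc_insert[OF insert.hyps(2,1)]
      by (rule sum.union_disjoint) (use fin insert.hyps in auto)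
    also have "(\<Sum>K\<in>insert x ` {K. K \<subseteq> A \<and> card K = k}. \<Prod>i\<in>K. a i) =
        (\<Sum>K | K \<subseteq> A \<and> card K = k. a x * (\<Prod>i\<in>K. a i))"
    proof (subst sum.reindex[OF inj], rule sum.cong[OF refl])
      fix K assume "K \<in> {K. K \<subseteq> A \<and> card K = k}"
      then have "finite K" "x \<notin> K" using insert.hyps by (auto intro: finite_subset)
      then show "((prod a) \<circ> insert x) K = a x * (\<Prod>i\<in>K. a i)" by simp
    qed
    also have "\<dots> = a x * (\<Sum>K | K \<subseteq> A \<and> card K = k. \<Prod>i\<in>K. a i)" by (simp add: sum_distrib_left)
    also have "(\<Sum>K | K \<subseteq> A \<and> card K = Suc k. \<Prod>i\<in>K. a i) + \<dots> \<le>
        S ^ Suc k / fact (Suc k) + a x * (S ^ k / fact k)"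
      unfolding S_def by (intro add_mono mult_left_mono IH) (use S in auto)
    also have "a x * (S ^ k / fact k) = real (Suc k) * a x * S ^ k / fact (Suc k)"
      by (simp add: fact_Suc del: of_nat_Suc)
    also have "S ^ Suc k / fact (Suc k) + \<dots> = (S ^ Suc k + real (Suc k) * a x * S ^ k) / fact (Suc k)"
      by (rule add_divide_distrib[symmetric])
    also have "\<dots> \<le> (S + a x) ^ Suc k / fact (Suc k)"
      by (intro divide_right_mono power_add_Suc_ge S) auto
    also have "S + a x = (\<Sum>i\<in>insert x A. a i)" using insert.hyps by (simp add: S_def)
    finally show ?thesis unfolding Suc .
  qed
qed

text \<open>The right-hand side is the falling factorial of \<open>u\<close>, whose \<open>m\<close>
  factors are all at least \<open>u - m\<close>. With \<open>m = n\<close> this is the source of the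
  denominator \<open>u - n\<close> in the budget bound.\<close>

lemma binomial_mult_fact_ge:
  assumes "m \<le> u"
  shows "real (u - m) ^ m \<le> fact m * real (u choose m)"
proof -
  have "real (u - m) ^ m = (\<Prod>i=0..<m. real (u - m))" by simp
  also have "\<dots> \<le> (\<Prod>i=0..<m. real u - real i)"
    by (intro prod_mono) (use assms in \<open>auto simp: of_nat_diff\<close>)
  also have "\<dots> = fact m * real (u choose m)"
    by (simp only: gbinomial_mult_fact binomial_gbinomial)
  finally show ?thesis .
qed

section \<open>Finite mixtures and integrals of bounded functions\<close>

lemma integral_uniform_bind:
  fixes f :: "'b \<Rightarrow> real"
  assumes A: "finite A" "A \<noteq> {}" and k: "\<And>x. x \<in> A \<Longrightarrow> k x \<in> space (prob_algebra L)"
  shows uniform_bind_prob_algebra: "uniform_count_measure A \<bind> k \<in> space (prob_algebra L)"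
    and "f \<in> borel_measurable L \<Longrightarrow> (\<And>x. x \<in> space L \<Longrightarrow> \<bar>f x\<bar> \<le> B) \<Longrightarrow>
      (\<integral>x. f x \<partial>(uniform_count_measure A \<bind> k)) = (\<Sum>a\<in>A. \<integral>x. f x \<partial>k a) / card A"
proof -
  interpret U: prob_space "uniform_count_measure A" by (rule prob_space_uniform_count_measure[OF A])
  have k': "k \<in> uniform_count_measure A \<rightarrow>\<^sub>M prob_algebra L"
    unfolding measurable_cong_sets[OF sets_uniform_count_measure_count_space refl]
    using k by simp
  have U: "uniform_count_measure A \<in> space (prob_algebra (uniform_count_measure A))"
    by (simp add: space_prob_algebra U.prob_space_axioms)
  show "uniform_count_measure A \<bind> k \<in> space (prob_algebra L)"
    using prob_space_bind'[OF U k'] sets_bind'[OF U k'] by (simp add: space_prob_algebra)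
  assume f: "f \<in> borel_measurable L" "\<And>x. x \<in> space L \<Longrightarrow> \<bar>f x\<bar> \<le> B"
  have "(\<integral>x. f x \<partial>(uniform_count_measure A \<bind> k)) = (\<integral>a. (\<integral>x. f x \<partial>k a) \<partial>uniform_count_measure A)"
    by (rule integral_bind[OF f measurable_prob_algebraD[OF k'] U.finite_measure_axioms, of 1])
       (use k in \<open>auto intro!: AE_I2 prob_space.emeasure_le_1 simp: space_prob_algebra space_uniform_count_measure\<close>)
  also have "\<dots> = (\<Sum>a\<in>A. \<integral>x. f x \<partial>k a) / card A" by (rule integral_uniform_count_measure[OF A(1)])
  finally show "(\<integral>x. f x \<partial>(uniform_count_measure A \<bind> k)) = (\<Sum>a\<in>A. \<integral>x. f x \<partial>k a) / card A" .
qed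

text \<open>Integrability is not asked for: a non-integrable \<open>f\<close> has Bochner integral
  \<open>0\<close>, which also obeys the bound.\<close>

lemma integral_prob_bounded:
  fixes f :: "'a \<Rightarrow> real"
  assumes "prob_space N" "\<And>x. x \<in> space N \<Longrightarrow> \<bar>f x\<bar> \<le> B" "0 \<le> B"
  shows "\<bar>\<integral>x. f x \<partial>N\<bar> \<le> B"
proof (cases "integrable N f")
  case True
  interpret prob_space N by fact
  have "\<bar>\<integral>x. f x \<partial>N\<bar> \<le> (\<integral>x. \<bar>f x\<bar> \<partial>N)" by (rule integral_abs_bound)
  also have "\<dots> \<le> (\<integral>x. B \<partial>N)" by (rule integral_mono) (use True assms in auto)
  finally show ?thesis by (simp add: prob_space)
qed (use assms in \<open>simp add: not_integrable_integral_eq\<close>)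

section \<open>State laws and score laws of a single tester\<close>

locale valid_tester =
  fixes u n :: nat and M :: "('r, 'w) tester"
  assumes tester: "membership_tester u n M"
begin

lemma n_pos: "0 < n" and n_less: "n < u" and shared_prob: "prob_space (shared M)"
  using tester by (auto simp: membership_tester_def)

abbreviation "KS \<equiv> key_sets u n"

lemma finite_KS: "finite KS" and card_KS: "card KS = u choose n"
  using n_subsets[of "{1..u}" n] by (auto simp: key_sets_def)

lemma card_KS_pos: "0 < card KS"
  unfolding card_KS using n_less by simp

lemma KS_nonempty: "KS \<noteq> {}"
  using card_KS_pos by auto

lemma KSD: "K \<in> KS \<Longrightarrow> K \<subseteq> {1..u}" "K \<in> KS \<Longrightarrow> card K = n" "K \<in> KS \<Longrightarrow> finite K"
  by (auto simp: key_sets_def intro: finite_subset)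

definition query_law :: "nat \<Rightarrow> 'r \<times> 'w \<Rightarrow> real measure" where
  "query_law i = (\<lambda>(r, w). query M r i w)"

lemma query_law_measurable: "i \<in> {1..u} \<Longrightarrow> query_law i \<in> state_space M \<rightarrow>\<^sub>M prob_algebra unit_borel"
  using tester by (simp add: membership_tester_def query_law_def)

lemma state_law_in: "K \<in> KS \<Longrightarrow> state_law M K \<in> space (prob_algebra (state_space M))"
proof -
  assume K: "K \<in> KS"
  have i: "(\<lambda>r. init M r K) \<in> shared M \<rightarrow>\<^sub>M prob_algebra (mem M)"
    using tester K by (simp add: membership_tester_def)
  have "(\<lambda>r. distr (init M r K) (state_space M) (Pair r)) \<in> shared M \<rightarrow>\<^sub>M prob_algebra (state_space M)"
    by (rule measurable_distr_prob_space2[OF i]) (simp add: state_space_def)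
  note ker = this
  have sh: "shared M \<in> space (prob_algebra (shared M))"
    by (simp add: space_prob_algebra shared_prob)
  show ?thesis
    using prob_space_bind'[OF sh ker] sets_bind'[OF sh ker]
    by (simp add: space_prob_algebra state_law_def)
qed

lemma state_lawD:
  assumes "K \<in> KS"
  shows "prob_space (state_law M K)" "sets (state_law M K) = sets (state_space M)"
    "space (state_law M K) = space (state_space M)"
  using state_law_in[OF assms] by (auto simp: space_prob_algebra dest: sets_eq_imp_space_eq)

lemma score_law_eq: "score_law M K i = state_law M K \<bind> query_law i"
  by (simp add: score_law_def query_law_def)

lemma score_law_in: "K \<in> KS \<Longrightarrow> i \<in> {1..u} \<Longrightarrow> score_law M K i \<in> prob_measures"
  unfolding score_law_eq using prob_space_bind'[OF state_law_in query_law_measurable] sets_bind'[OF state_law_in query_law_measurable]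
  by (simp add: space_prob_algebra)

lemma key_score_law_in: "key_score_law u n M \<in> prob_measures"
  unfolding key_score_law_def
  by (intro uniform_bind_prob_algebra finite_KS KS_nonempty score_law_in) (use KSD n_pos in fastforce)+

lemma nonkey_nonempty: "K \<in> KS \<Longrightarrow> {1..u} - K \<noteq> {}" "K \<in> KS \<Longrightarrow> card ({1..u} - K) = u - n"
proof -
  assume K: "K \<in> KS"
  show *: "card ({1..u} - K) = u - n" using KSD[OF K] by (simp add: card_Diff_subset)
  show "{1..u} - K \<noteq> {}" using * n_less by (metis card.empty less_numeral_extra(3) zero_less_diff)
qed

lemma nonkey_score_law_in: "nonkey_score_law u n M \<in> prob_measures"
  unfolding nonkey_score_law_def
  by (intro uniform_bind_prob_algebra finite_KS KS_nonempty score_law_in nonkey_nonempty) auto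

lemma query_law_prob: "i \<in> {1..u} \<Longrightarrow> s \<in> space (state_space M) \<Longrightarrow> prob_space (query_law i s)"
  using measurable_space[OF query_law_measurable] by (auto simp: space_prob_algebra)

lemma query_law_sets: "i \<in> {1..u} \<Longrightarrow> s \<in> space (state_space M) \<Longrightarrow> sets (query_law i s) = sets unit_borel"
  using measurable_space[OF query_law_measurable] by (auto simp: space_prob_algebra)

context
  fixes f :: "real \<Rightarrow> real" and B :: real
  assumes f: "f \<in> borel_measurable unit_borel" and fB: "\<And>x. \<bar>f x\<bar> \<le> B"
begin

lemma B_nonneg: "0 \<le> B" using fB[of 0] by simp

lemma query_law_integral_measurable: "i \<in> {1..u} \<Longrightarrow> (\<lambda>s. \<integral>x. f x \<partial>query_law i s) \<in> borel_measurable (state_space M)"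
  using integral_measurable_subprob_algebra[OF f] measurable_prob_algebraD[OF query_law_measurable]
  by (rule measurable_compose[rotated])

lemma query_law_integral_bound: "i \<in> {1..u} \<Longrightarrow> s \<in> space (state_space M) \<Longrightarrow> \<bar>\<integral>x. f x \<partial>query_law i s\<bar> \<le> B"
  by (rule integral_prob_bounded[OF query_law_prob fB B_nonneg])

lemma integral_score_law:
  assumes K: "K \<in> KS" and i: "i \<in> {1..u}"
  shows "(\<integral>x. f x \<partial>score_law M K i) = (\<integral>s. (\<integral>x. f x \<partial>query_law i s) \<partial>state_law M K)"
proof -
  interpret prob_space "state_law M K" by (rule state_lawD[OF K])
  have Qm: "query_law i \<in> state_law M K \<rightarrow>\<^sub>M prob_algebra unit_borel"
    using query_law_measurable[OF i] state_lawD(2)[OF K] by (simp cong: measurable_cong_sets)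
  show ?thesis unfolding score_law_eq
    by (rule integral_bind[OF f fB measurable_prob_algebraD[OF Qm] finite_measure_axioms, of 1])
       (use query_law_prob[OF i] state_lawD(3)[OF K] in \<open>auto intro!: AE_I2 prob_space.emeasure_le_1\<close>)
qed

lemma integral_key_score_law:
  "(\<integral>x. f x \<partial>key_score_law u n M) = (\<Sum>K\<in>KS. (\<Sum>i\<in>K. \<integral>x. f x \<partial>score_law M K i) / n) / card KS"
proof -
  have ne: "finite K" "K \<noteq> {}" if "K \<in> KS" for K using KSD[OF that] n_pos by auto
  have sl: "score_law M K i \<in> prob_measures" if "K \<in> KS" "i \<in> K" for K i
    using score_law_in[OF that(1)] KSD(1)[OF that(1)] that(2) by blast
  have "(\<integral>x. f x \<partial>key_score_law u n M) =
      (\<Sum>K\<in>KS. \<integral>x. f x \<partial>(uniform_count_measure K \<bind> (\<lambda>J. score_law M K J))) / card KS"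
    unfolding key_score_law_def
    by (rule integral_uniform_bind(2)[OF finite_KS KS_nonempty uniform_bind_prob_algebra[OF ne sl] f fB])
  also have "\<dots> = (\<Sum>K\<in>KS. (\<Sum>i\<in>K. \<integral>x. f x \<partial>score_law M K i) / n) / card KS"
    by (intro arg_cong2[where f="(/)"] sum.cong refl)
       (simp add: integral_uniform_bind(2)[OF ne sl f fB] KSD)
  finally show ?thesis .
qed

lemma integral_nonkey_score_law:
  "(\<integral>x. f x \<partial>nonkey_score_law u n M) =
    (\<Sum>K\<in>KS. (\<Sum>i\<in>{1..u} - K. \<integral>x. f x \<partial>score_law M K i) / (u - n)) / card KS"
proof -
  have ne: "finite ({1..u} - K)" "{1..u} - K \<noteq> {}" if "K \<in> KS" for K using nonkey_nonempty[OF that] by auto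
  have sl: "score_law M K i \<in> prob_measures" if "K \<in> KS" "i \<in> {1..u} - K" for K i
    using score_law_in[OF that(1)] that(2) by blast
  have "(\<integral>x. f x \<partial>nonkey_score_law u n M) =
      (\<Sum>K\<in>KS. \<integral>x. f x \<partial>(uniform_count_measure ({1..u} - K) \<bind> (\<lambda>J. score_law M K J))) / card KS"
    unfolding nonkey_score_law_def
    by (rule integral_uniform_bind(2)[OF finite_KS KS_nonempty uniform_bind_prob_algebra[OF ne sl] f fB])
  also have "\<dots> = (\<Sum>K\<in>KS. (\<Sum>i\<in>{1..u} - K. \<integral>x. f x \<partial>score_law M K i) / (u - n)) / card KS"
    by (intro arg_cong2[where f="(/)"] sum.cong refl)
       (use integral_uniform_bind(2)[OF ne sl f fB] nonkey_nonempty in simp)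
  finally show ?thesis .
qed

end

section \<open>The joint law of state and key set against the product of its marginals\<close>

abbreviation "J \<equiv> joint_law u n M"
abbreviation "T \<equiv> count_space KS"
abbreviation "S \<equiv> state_space M"

lemma joint_kernel_in:
  assumes "K \<in> KS"
  shows "distr (state_law M K) (S \<Otimes>\<^sub>M T) (\<lambda>s. (s, K)) \<in> space (prob_algebra (S \<Otimes>\<^sub>M T))"
    and "(\<lambda>s. (s, K)) \<in> state_law M K \<rightarrow>\<^sub>M S \<Otimes>\<^sub>M T"
proof -
  show m: "(\<lambda>s. (s, K)) \<in> state_law M K \<rightarrow>\<^sub>M S \<Otimes>\<^sub>M T"
    unfolding measurable_cong_sets[OF state_lawD(2)[OF assms] refl]
    using assms by (intro measurable_Pair2') simp
  show "distr (state_law M K) (S \<Otimes>\<^sub>M T) (\<lambda>s. (s, K)) \<in> space (prob_algebra (S \<Otimes>\<^sub>M T))"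
    using prob_space.prob_space_distr[OF state_lawD(1)[OF assms] m] by (simp add: space_prob_algebra)
qed

lemma joint_law_in: "J \<in> space (prob_algebra (S \<Otimes>\<^sub>M T))"
  unfolding joint_law_def by (intro uniform_bind_prob_algebra finite_KS KS_nonempty joint_kernel_in(1))

lemma joint_law_prob: "prob_space J" and joint_law_sets: "sets J = sets (S \<Otimes>\<^sub>M T)"
  using joint_law_in by (auto simp: space_prob_algebra)

lemma integral_joint_law:
  fixes h :: "('r \<times> 'w) \<times> nat set \<Rightarrow> real"
  assumes h: "h \<in> borel_measurable (S \<Otimes>\<^sub>M T)" "\<And>x. x \<in> space (S \<Otimes>\<^sub>M T) \<Longrightarrow> \<bar>h x\<bar> \<le> B"
  shows "(\<integral>x. h x \<partial>J) = (\<Sum>K\<in>KS. \<integral>s. h (s, K) \<partial>state_law M K) / card KS"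
proof -
  have "(\<integral>x. h x \<partial>J) =
      (\<Sum>K\<in>KS. \<integral>x. h x \<partial>distr (state_law M K) (S \<Otimes>\<^sub>M T) (\<lambda>s. (s, K))) / card KS"
    unfolding joint_law_def
    by (rule integral_uniform_bind(2)[OF finite_KS KS_nonempty joint_kernel_in(1) h])
  also have "\<dots> = (\<Sum>K\<in>KS. \<integral>s. h (s, K) \<partial>state_law M K) / card KS"
    by (intro arg_cong2[where f="(/)"] sum.cong refl integral_distr joint_kernel_in(2) h(1))
  finally show ?thesis .
qed

definition product_law :: "(('r \<times> 'w) \<times> nat set) measure" where
  "product_law = distr J S fst \<Otimes>\<^sub>M distr J T snd"

lemma fst_J: "fst \<in> J \<rightarrow>\<^sub>M S" and snd_J: "snd \<in> J \<rightarrow>\<^sub>M T"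
  by (simp_all add: measurable_cong_sets[OF joint_law_sets refl])

lemma product_law_prob: "prob_space product_law"
  unfolding product_law_def by (intro prob_space_pair prob_space.prob_space_distr joint_law_prob fst_J snd_J)

lemma product_law_sets: "sets product_law = sets (S \<Otimes>\<^sub>M T)"
  unfolding product_law_def by (rule sets_pair_measure_cong) simp_all

lemma product_law_space: "space product_law = space (S \<Otimes>\<^sub>M T)"
  by (rule sets_eq_imp_space_eq[OF product_law_sets])

lemma memory_budget_eq: "memory_budget u n M = KL_divergence 2 product_law J"
proof -
  have "distr J (S \<Otimes>\<^sub>M T) (\<lambda>x. (fst x, snd x)) = J"
    using joint_law_sets by (simp add: distr_id2)
  then show ?thesis
    unfolding memory_budget_def prob_space.mutual_information_def[OF joint_law_prob] product_law_def by simp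
qed

text \<open>Both marginals are read off the joint law: the key set is uniform, and the state is the
  uniform mixture of the state laws. In the double average \<open>K'\<close> is the key set that
  produced the state, and \<open>K\<close> is an independent candidate compared with it.\<close>

lemma integral_product_law:
  fixes h :: "('r \<times> 'w) \<times> nat set \<Rightarrow> real"
  assumes h: "h \<in> borel_measurable (S \<Otimes>\<^sub>M T)" "\<And>x. x \<in> space (S \<Otimes>\<^sub>M T) \<Longrightarrow> \<bar>h x\<bar> \<le> B"
  shows "(\<integral>x. h x \<partial>product_law) =
    (\<Sum>K'\<in>KS. \<integral>s. (\<Sum>K\<in>KS. h (s, K)) / card KS \<partial>state_law M K') / card KS"
proof -
  interpret DS: prob_space "distr J S fst" by (rule prob_space.prob_space_distr[OF joint_law_prob fst_J])
  interpret DT: prob_space "distr J T snd" by (rule prob_space.prob_space_distr[OF joint_law_prob snd_J])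
  interpret pair_prob_space "distr J S fst" "distr J T snd" ..
  have hR: "integrable product_law h"
    by (rule bounded_measurable_integrable[OF _ product_law_sets h])
       (use product_law_prob in \<open>simp add: prob_space_def\<close>)
  have hK: "(\<lambda>s. h (s, K)) \<in> borel_measurable S" if "K \<in> KS" for K
    using measurable_compose[OF measurable_Pair2' h(1)] that by simp
  have inner: "(\<integral>K. h (s, K) \<partial>distr J T snd) = (\<Sum>K\<in>KS. h (s, K)) / card KS" if s: "s \<in> space S" for s
  proof -
    have "(\<integral>K. h (s, K) \<partial>distr J T snd) = (\<integral>x. h (s, snd x) \<partial>J)"
      by (rule integral_distr[OF snd_J]) simp
    also have "\<dots> = (\<Sum>K\<in>KS. \<integral>s'. h (s, snd (s', K)) \<partial>state_law M K) / card KS"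
    proof (rule integral_joint_law)
      show "(\<lambda>x. h (s, snd x)) \<in> borel_measurable (S \<Otimes>\<^sub>M T)"
        by (rule measurable_compose[OF measurable_snd]) simp
      show "\<bar>h (s, snd x)\<bar> \<le> B" if "x \<in> space (S \<Otimes>\<^sub>M T)" for x
        using h(2)[of "(s, snd x)"] s that by (auto simp: space_pair_measure)
    qed
    also have "\<dots> = (\<Sum>K\<in>KS. h (s, K)) / card KS"
      using state_lawD(1) by (simp add: prob_space.prob_space)
    finally show ?thesis .
  qed
  have "(\<integral>x. h x \<partial>product_law) = (\<integral>s. (\<integral>K. h (s, K) \<partial>distr J T snd) \<partial>distr J S fst)"
    unfolding product_law_def by (rule integral_fst'[symmetric]) (use hR in \<open>simp add: product_law_def\<close>)
  also have "\<dots> = (\<integral>s. (\<Sum>K\<in>KS. h (s, K)) / card KS \<partial>distr J S fst)"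
    by (rule Bochner_Integration.integral_cong[OF refl]) (simp add: inner)
  also have "\<dots> = (\<integral>x. (\<Sum>K\<in>KS. h (fst x, K)) / card KS \<partial>J)"
    by (rule integral_distr[OF fst_J]) (use hK in measurable)
  also have "\<dots> = (\<Sum>K'\<in>KS. \<integral>s. (\<Sum>K\<in>KS. h (fst (s, K'), K)) / card KS \<partial>state_law M K') / card KS"
  proof (rule integral_joint_law)
    show "(\<lambda>x. (\<Sum>K\<in>KS. h (fst x, K)) / card KS) \<in> borel_measurable (S \<Otimes>\<^sub>M T)"
      by (rule measurable_compose[OF measurable_fst]) (use hK in measurable)
    fix x assume x: "x \<in> space (S \<Otimes>\<^sub>M T)"
    have "\<bar>\<Sum>K\<in>KS. h (fst x, K)\<bar> \<le> (\<Sum>K\<in>KS. \<bar>h (fst x, K)\<bar>)" by (rule sum_abs)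
    also have "\<dots> \<le> card KS * B"
      by (rule sum_bounded_above) (use h(2) x in \<open>auto simp: space_pair_measure\<close>)
    finally show "\<bar>(\<Sum>K\<in>KS. h (fst x, K)) / card KS\<bar> \<le> B"
      using card_KS_pos by (simp add: field_simps)
  qed
  finally show ?thesis by simp
qed

lemma average_integrable:
  fixes h :: "('r \<times> 'w) \<times> nat set \<Rightarrow> real"
  assumes h: "h \<in> borel_measurable (S \<Otimes>\<^sub>M T)" "\<And>x. x \<in> space (S \<Otimes>\<^sub>M T) \<Longrightarrow> \<bar>h x\<bar> \<le> B" and "K' \<in> KS"
  shows "integrable (state_law M K') (\<lambda>s. h (s, K'))"
    and "integrable (state_law M K') (\<lambda>s. (\<Sum>K\<in>KS. h (s, K)) / card KS)"
proof -
  interpret prob_space "state_law M K'" by (rule state_lawD[OF assms(3)])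
  have *: "integrable (state_law M K') (\<lambda>s. h (s, K))" if "K \<in> KS" for K
  proof (rule bounded_measurable_integrable[OF finite_measure_axioms state_lawD(2)[OF assms(3)]])
    show "(\<lambda>s. h (s, K)) \<in> borel_measurable S"
      using measurable_compose[OF measurable_Pair2' h(1)] that by simp
    show "\<bar>h (s, K)\<bar> \<le> B" if "s \<in> space S" for s
      using h(2) that \<open>K \<in> KS\<close> by (auto simp: space_pair_measure)
  qed
  show "integrable (state_law M K') (\<lambda>s. h (s, K'))" by (rule *[OF assms(3)])
  show "integrable (state_law M K') (\<lambda>s. (\<Sum>K\<in>KS. h (s, K)) / card KS)"
    using * by (intro integrable_divide Bochner_Integration.integrable_sum) auto
qed

text \<open>In the product the independent candidate coincides with the true key set with
  probability \<open>1 / card KS\<close>. Keeping only that term of the inner average bounds the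
  density of the joint law by \<open>card KS\<close>.\<close>

lemma integral_joint_law_le_product_law:
  fixes h :: "('r \<times> 'w) \<times> nat set \<Rightarrow> real"
  assumes h: "h \<in> borel_measurable (S \<Otimes>\<^sub>M T)" "\<And>x. x \<in> space (S \<Otimes>\<^sub>M T) \<Longrightarrow> \<bar>h x\<bar> \<le> B"
    and nonneg: "\<And>x. 0 \<le> h x"
  shows "(\<integral>x. h x \<partial>J) \<le> card KS * (\<integral>x. h x \<partial>product_law)"
proof -
  have "(\<integral>s. h (s, K') \<partial>state_law M K') \<le> card KS * (\<integral>s. (\<Sum>K\<in>KS. h (s, K)) / card KS \<partial>state_law M K')"
    if K': "K' \<in> KS" for K'
  proof -
    have "h (s, K') \<le> card KS * ((\<Sum>K\<in>KS. h (s, K)) / card KS)" for s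
      using member_le_sum[of K' KS "\<lambda>K. h (s, K)"] K' finite_KS KS_nonempty nonneg by simp
    then have "(\<integral>s. h (s, K') \<partial>state_law M K') \<le> (\<integral>s. card KS * ((\<Sum>K\<in>KS. h (s, K)) / card KS) \<partial>state_law M K')"
      by (intro integral_mono average_integrable[OF h K'] integrable_mult_right)
    then show ?thesis by (simp only: integral_mult_right_zero)
  qed
  note le = this
  have r: "(\<integral>x. h x \<partial>product_law) = (\<Sum>K'\<in>KS. \<integral>s. (\<Sum>K\<in>KS. h (s, K)) / card KS \<partial>state_law M K') / card KS"
    by (rule integral_product_law[OF h])
  have "(\<integral>x. h x \<partial>J) = (\<Sum>K'\<in>KS. \<integral>s. h (s, K') \<partial>state_law M K') / card KS"
    by (rule integral_joint_law[OF h])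
  also have "\<dots> \<le> (\<Sum>K'\<in>KS. card KS * (\<integral>s. (\<Sum>K\<in>KS. h (s, K)) / card KS \<partial>state_law M K')) / card KS"
    by (intro divide_right_mono sum_mono le) auto
  also have "\<dots> = card KS * (\<integral>x. h x \<partial>product_law)"
    unfolding r by (simp only: sum_distrib_left[symmetric] times_divide_eq_right)
  finally show ?thesis .
qed

text \<open>Since the key set takes only finitely many values, the joint law is dominated by a multiple
  of the product law. Hence the mutual information is a genuine finite integral, not a junk
  value, and the variational inequality applies to it.\<close>

lemma memory_budget_variational:
  assumes F: "F \<in> borel_measurable (S \<Otimes>\<^sub>M T)" "\<And>x. x \<in> space (S \<Otimes>\<^sub>M T) \<Longrightarrow> \<bar>F x\<bar> \<le> B"
  shows "(\<integral>x. F x \<partial>J) - (\<integral>x. exp (F x) \<partial>product_law) + 1 \<le> ln 2 * memory_budget u n M"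
proof -
  interpret J: prob_space J by (rule joint_law_prob)
  have sets: "sets J = sets product_law" by (simp add: joint_law_sets product_law_sets)
  let ?N = "real (card KS)"
  have N: "0 < ?N" using card_KS_pos by simp
  \<comment> \<open>\<open>ln ?N\<close> is the entropy in nats of the uniform key set. Pointwise,
    \<open>young_ln_exp\<close> at \<open>y = ?N\<close>, divided by \<open>?N\<close>, gives
    \<open>G - exp G / ?N \<le> ln ?N - 1\<close>; domination by the product law then replaces the
    exponential integral.\<close>
  have bound: "(\<integral>x. G x \<partial>J) - (\<integral>x. exp (G x) \<partial>product_law) + 1 \<le> ln ?N"
    if G': "G \<in> borel_measurable product_law" and GB: "\<And>x. \<bar>G x\<bar> \<le> C" for G C
  proof -
    have G: "G \<in> borel_measurable (S \<Otimes>\<^sub>M T)" using G' by (simp add: measurable_cong_sets[OF product_law_sets refl])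
    then have eG: "(\<lambda>x. exp (G x)) \<in> borel_measurable (S \<Otimes>\<^sub>M T)" by measurable
    have eB: "\<bar>exp (G x)\<bar> \<le> exp C" for x using GB[of x] by simp
    have i: "integrable J G" by (rule bounded_measurable_integrable[OF J.finite_measure_axioms joint_law_sets G GB])
    have ie: "integrable J (\<lambda>x. exp (G x))" by (rule bounded_measurable_integrable[OF J.finite_measure_axioms joint_law_sets eG eB])
    have "(\<integral>x. G x \<partial>J) - (\<integral>x. exp (G x) \<partial>J) / ?N = (\<integral>x. G x - exp (G x) / ?N \<partial>J)"
      using i ie by simp
    also have "\<dots> \<le> (\<integral>x. ln ?N - 1 \<partial>J)"
    proof (rule integral_mono)
      show "G x - exp (G x) / ?N \<le> ln ?N - 1" for x
        using young_ln_exp[of ?N "G x"] N by (simp add: field_simps)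
    qed (use i ie in auto)
    finally have "(\<integral>x. G x \<partial>J) - (\<integral>x. exp (G x) \<partial>J) / ?N \<le> ln ?N - 1" by (simp add: J.prob_space)
    moreover have "(\<integral>x. exp (G x) \<partial>J) / ?N \<le> (\<integral>x. exp (G x) \<partial>product_law)"
      using integral_joint_law_le_product_law[OF eG eB] N by (simp add: field_simps)
    ultimately show ?thesis by linarith
  qed
  note U = KL_divergence_variational_upper[OF product_law_prob joint_law_prob sets, where b=2 and C="ln ?N"]
  have ac: "absolutely_continuous product_law J" by (rule U(1)) (simp, rule bound)
  have int: "integrable J (entropy_density 2 product_law J)" by (rule U(2)) (simp, rule bound)
  show ?thesis unfolding memory_budget_eq
    by (rule KL_divergence_variational_lower[OF product_law_prob joint_law_prob sets _ ac int])
       (use F in \<open>simp_all add: measurable_cong_sets[OF product_law_sets refl] product_law_space\<close>)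
qed

text \<open>Jensen's inequality, by the tangent to \<open>exp\<close> at the mean \<open>c\<close>.
  It accounts for private coins of the query: an exponential of a mean score is replaced by a mean
  of exponentials, which is linear in the score law.\<close>

lemma exp_integral_le:
  fixes f :: "real \<Rightarrow> real"
  assumes f: "f \<in> borel_measurable unit_borel" and fB: "\<And>x. \<bar>f x\<bar> \<le> B"
    and i: "i \<in> {1..u}" and s: "s \<in> space S"
  shows "exp (\<integral>x. f x \<partial>query_law i s) \<le> (\<integral>x. exp (f x) \<partial>query_law i s)"
proof -
  interpret prob_space "query_law i s" by (rule query_law_prob[OF i s])
  have i1: "integrable (query_law i s) f"
    by (rule bounded_measurable_integrable[OF finite_measure_axioms query_law_sets[OF i s] f, OF fB])
  have i2: "integrable (query_law i s) (\<lambda>x. exp (f x))"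
    by (rule exp_bounded_measurable_integrable[OF finite_measure_axioms query_law_sets[OF i s] f, OF fB])
  define c where "c = (\<integral>x. f x \<partial>query_law i s)"
  have "exp c * (1 + (f x - c)) \<le> exp (f x)" for x
    using mult_left_mono[OF exp_ge_add_one_self[of "f x - c"], of "exp c"] by (simp flip: exp_add)
  then have "(\<integral>x. exp c * (1 + (f x - c)) \<partial>query_law i s) \<le> (\<integral>x. exp (f x) \<partial>query_law i s)"
    by (intro integral_mono) (use i1 i2 in auto)
  then show ?thesis using i1 by (simp add: prob_space c_def)
qed

text \<open>The test function is the log-likelihood score
  \<open>F(s, K) = \<Sum>i\<in>K. \<phi> i s\<close> of \<open>K\<close> being the key set,
  where \<open>\<phi> i s\<close> is the mean of \<open>f\<close> over the score of \<open>i\<close>,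
  normalised by \<open>n (t s - 1)\<close>, which makes the average of \<open>exp F\<close> over all
  key sets at most \<open>1\<close> for every single state \<open>s\<close>: this average is an elementary
  symmetric mean, bounded by \<open>t s ^ n\<close>. Using the denominator \<open>u - n\<close> instead of
  \<open>u\<close> in \<open>t\<close> costs a factor that disappears in the limit and spares
  Maclaurin's inequality.\<close>

lemma memory_budget_ge:
  assumes f: "f \<in> borel_measurable unit_borel" and fB: "\<And>x. \<bar>f x\<bar> \<le> B"
  shows "n * ((\<integral>x. f x \<partial>key_score_law u n M) - real n / real (u - n) * (\<integral>x. exp (f x) \<partial>key_score_law u n M)
      - (\<integral>x. exp (f x) \<partial>nonkey_score_law u n M) + 1) \<le> ln 2 * memory_budget u n M"
proof -
  let ?e = "\<lambda>x. exp (f x)"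
  let ?N = "real (card KS)"
  have N: "0 < ?N" using card_KS_pos by simp
  have e: "?e \<in> borel_measurable unit_borel" using f by measurable
  have eB: "\<bar>?e x\<bar> \<le> exp B" for x using fB[of x] by simp
  have un: "0 < real (u - n)" using n_less by simp
  define \<phi> where "\<phi> = (\<lambda>i s. \<integral>x. f x \<partial>query_law i s)"
  define \<psi> where "\<psi> = (\<lambda>i s. \<integral>x. exp (f x) \<partial>query_law i s)"
  define t where "t = (\<lambda>s. (\<Sum>i\<in>{1..u}. \<psi> i s) / real (u - n))"
  have \<phi>m[measurable]: "\<phi> i \<in> borel_measurable S" if "i \<in> {1..u}" for i
    using query_law_integral_measurable[OF f fB that] by (simp add: \<phi>_def)
  have \<psi>m[measurable]: "\<psi> i \<in> borel_measurable S" if "i \<in> {1..u}" for i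
    using query_law_integral_measurable[OF e eB that] by (simp add: \<psi>_def)
  have \<phi>B: "\<bar>\<phi> i s\<bar> \<le> B" if "i \<in> {1..u}" "s \<in> space S" for i s
    using query_law_integral_bound[OF f fB that] by (simp add: \<phi>_def)
  have \<psi>B: "\<bar>\<psi> i s\<bar> \<le> exp B" if "i \<in> {1..u}" "s \<in> space S" for i s
    using query_law_integral_bound[OF e eB that] by (simp add: \<psi>_def)
  have \<phi>\<psi>: "exp (\<phi> i s) \<le> \<psi> i s" if "i \<in> {1..u}" "s \<in> space S" for i s
    using exp_integral_le[OF f fB that] by (simp add: \<phi>_def \<psi>_def)
  have tm: "t \<in> borel_measurable S" unfolding t_def by measurable
  have B0: "0 \<le> B" using fB[of 0] by simp
  define X where "X = u * exp B / real (u - n)"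
  have tB: "\<bar>t s\<bar> \<le> X" if "s \<in> space S" for s
  proof -
    have "\<bar>\<Sum>i\<in>{1..u}. \<psi> i s\<bar> \<le> (\<Sum>i\<in>{1..u}. \<bar>\<psi> i s\<bar>)" by (rule sum_abs)
    also have "\<dots> \<le> real (card {1..u}) * exp B" by (rule sum_bounded_above) (use \<psi>B that in auto)
    finally show ?thesis using un by (simp add: t_def X_def divide_right_mono)
  qed
  \<comment> \<open>Summing over the fixed index set \<open>{1..u}\<close> with an indicator makes
    measurability in the pair evident; \<open>FK\<close> recovers the sum over
    \<open>K\<close>.\<close>
  define F where "F = (\<lambda>x :: ('r \<times> 'w) \<times> nat set.
    (\<Sum>i\<in>{1..u}. indicator {K. i \<in> K} (snd x) * \<phi> i (fst x)) - n * (t (fst x) - 1))"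
  have Fm: "F \<in> borel_measurable (S \<Otimes>\<^sub>M T)"
  proof -
    have [measurable]: "(\<lambda>x. indicator {K. i \<in> K} (snd x) :: real) \<in> borel_measurable (S \<Otimes>\<^sub>M T)" for i :: nat
      by (rule measurable_compose[OF measurable_snd]) simp
    have [measurable]: "(\<lambda>x. \<phi> i (fst x)) \<in> borel_measurable (S \<Otimes>\<^sub>M T)" if "i \<in> {1..u}" for i
      by (rule measurable_compose[OF measurable_fst \<phi>m[OF that]])
    have [measurable]: "(\<lambda>x. t (fst x)) \<in> borel_measurable (S \<Otimes>\<^sub>M T)"
      by (rule measurable_compose[OF measurable_fst tm])
    show ?thesis unfolding F_def by measurable
  qed
  define C where "C = u * B + n * (X + 1)"
  have FB: "\<bar>F x\<bar> \<le> C" if x: "x \<in> space (S \<Otimes>\<^sub>M T)" for x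
  proof -
    have s: "fst x \<in> space S" using x by (auto simp: space_pair_measure)
    have "\<bar>\<Sum>i\<in>{1..u}. indicator {K. i \<in> K} (snd x) * \<phi> i (fst x)\<bar>
      \<le> (\<Sum>i\<in>{1..u}. \<bar>indicator {K. i \<in> K} (snd x) * \<phi> i (fst x)\<bar>)" by (rule sum_abs)
    also have "\<dots> \<le> real (card {1..u}) * B"
      by (rule sum_bounded_above) (use \<phi>B s B0 in \<open>auto split: split_indicator\<close>)
    finally have 1: "\<bar>\<Sum>i\<in>{1..u}. indicator {K. i \<in> K} (snd x) * \<phi> i (fst x)\<bar> \<le> u * B" by simp
    have "\<bar>t (fst x) - 1\<bar> \<le> X + 1" using tB[OF s] by linarith
    then have "\<bar>n * (t (fst x) - 1)\<bar> \<le> n * (X + 1)"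
      by (simp add: abs_mult mult_left_mono)
    with 1 show ?thesis unfolding F_def C_def by linarith
  qed
  have FK: "F (s, K) = (\<Sum>i\<in>K. \<phi> i s) - n * (t s - 1)" if "K \<in> KS" for s K
  proof -
    have "(\<Sum>i\<in>{1..u}. indicator {K. i \<in> K} K * \<phi> i s) = (\<Sum>i\<in>K. \<phi> i s)"
      using KSD(1)[OF that] by (intro sum.mono_neutral_cong_right) (auto split: split_indicator)
    then show ?thesis by (simp add: F_def)
  qed
  have eFm: "(\<lambda>x. exp (F x)) \<in> borel_measurable (S \<Otimes>\<^sub>M T)" using Fm by measurable
  have eFB: "\<bar>exp (F x)\<bar> \<le> exp C" if "x \<in> space (S \<Otimes>\<^sub>M T)" for x using FB[OF that] by simp
  have avg: "(\<Sum>K\<in>KS. exp (F (s, K))) / ?N \<le> 1" if s: "s \<in> space S" for s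
  proof -
    have \<psi>0: "0 \<le> \<psi> i s" if "i \<in> {1..u}" for i using \<phi>\<psi>[OF that s] by (smt (verit) exp_ge_zero)
    have t0: "0 \<le> t s" unfolding t_def using \<psi>0 by (intro divide_nonneg_nonneg sum_nonneg) auto
    have "(\<Sum>K\<in>KS. exp (F (s, K))) \<le> (\<Sum>K\<in>KS. (\<Prod>i\<in>K. \<psi> i s) * exp (- (n * (t s - 1))))"
    proof (rule sum_mono)
      fix K assume K: "K \<in> KS"
      have "exp (F (s, K)) = (\<Prod>i\<in>K. exp (\<phi> i s)) * exp (- (n * (t s - 1)))"
        unfolding FK[OF K] using KSD(3)[OF K] by (simp add: exp_diff exp_minus exp_sum divide_inverse)
      also have "\<dots> \<le> (\<Prod>i\<in>K. \<psi> i s) * exp (- (n * (t s - 1)))"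
        using KSD(1)[OF K] \<phi>\<psi>[OF _ s] by (intro mult_right_mono prod_mono) auto
      finally show "exp (F (s, K)) \<le> (\<Prod>i\<in>K. \<psi> i s) * exp (- (n * (t s - 1)))" .
    qed
    also have "\<dots> = (\<Sum>K\<in>KS. \<Prod>i\<in>K. \<psi> i s) * exp (- (n * (t s - 1)))" by (rule sum_distrib_right[symmetric])
    also have "\<dots> \<le> ((\<Sum>i\<in>{1..u}. \<psi> i s) ^ n / fact n) * exp (- (n * (t s - 1)))"
      unfolding key_sets_def by (intro mult_right_mono elementary_symmetric_le \<psi>0) auto
    also have "\<dots> = (real (u - n) ^ n / fact n) * (t s ^ n * exp (- (n * (t s - 1))))"
      using un by (simp add: t_def power_divide)
    also have "\<dots> \<le> ?N * 1"
    proof (rule mult_mono)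
      show "real (u - n) ^ n / fact n \<le> ?N"
        using binomial_mult_fact_ge[of n u] n_less by (simp add: card_KS field_simps)
      \<comment> \<open>The exact normaliser would be \<open>n * ln (t s)\<close>. Its upper bound
        \<open>n * (t s - 1)\<close> still keeps the average at most \<open>1\<close>, and being
        affine in \<open>t s\<close> it has a mean expressible through the score laws.\<close>
      have "t s \<le> exp (t s - 1)" using exp_ge_add_one_self[of "t s - 1"] by simp
      then have "t s ^ n \<le> exp (t s - 1) ^ n" using t0 by (rule power_mono)
      also have "\<dots> = exp (n * (t s - 1))" by (simp add: exp_of_nat_mult)
      finally have "t s ^ n * exp (- (n * (t s - 1))) \<le> exp (n * (t s - 1)) * exp (- (n * (t s - 1)))"
        by (rule mult_right_mono) simp
      then show "t s ^ n * exp (- (n * (t s - 1))) \<le> 1" by (simp flip: exp_add)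
    qed (use t0 in auto)
    finally show ?thesis using N by simp
  qed
  have "(\<integral>s. (\<Sum>K\<in>KS. exp (F (s, K))) / ?N \<partial>state_law M K') \<le> 1" if K': "K' \<in> KS" for K'
  proof -
    interpret prob_space "state_law M K'" by (rule state_lawD[OF K'])
    have "(\<integral>s. (\<Sum>K\<in>KS. exp (F (s, K))) / ?N \<partial>state_law M K') \<le> (\<integral>s. 1 \<partial>state_law M K')"
      by (intro integral_mono average_integrable[OF eFm eFB K'])
         (use avg state_lawD(3)[OF K'] in auto)
    then show ?thesis by (simp add: prob_space)
  qed
  then have "(\<Sum>K'\<in>KS. \<integral>s. (\<Sum>K\<in>KS. exp (F (s, K))) / ?N \<partial>state_law M K') \<le> ?N * 1"
    by (rule sum_bounded_above)
  moreover have "(\<integral>x. exp (F x) \<partial>product_law) =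
      (\<Sum>K'\<in>KS. \<integral>s. (\<Sum>K\<in>KS. exp (F (s, K))) / ?N \<partial>state_law M K') / ?N"
    by (rule integral_product_law[OF eFm eFB])
  ultimately have expR: "(\<integral>x. exp (F x) \<partial>product_law) \<le> 1"
    using N by (simp only: pos_divide_le_eq mult_1 mult_1_right)
  let ?a = "\<lambda>K i. \<integral>x. f x \<partial>score_law M K i"
  let ?b = "\<lambda>K i. \<integral>x. exp (f x) \<partial>score_law M K i"
  \<comment> \<open>Under the joint law the state was produced by \<open>K\<close> itself, so in the
    sum over the universe defining \<open>t\<close> the indices in \<open>K\<close> carry key scores
    and the others non-key scores. The former yield the correction with weight
    \<open>n / (u - n)\<close>.\<close>
  have FJ: "(\<integral>s. F (s, K) \<partial>state_law M K) =
      (\<Sum>i\<in>K. ?a K i) - n * (((\<Sum>i\<in>K. ?b K i) + (\<Sum>i\<in>{1..u} - K. ?b K i)) / real (u - n) - 1)"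
    if K: "K \<in> KS" for K
  proof -
    interpret prob_space "state_law M K" by (rule state_lawD[OF K])
    note bi = bounded_measurable_integrable[OF finite_measure_axioms state_lawD(2)[OF K]]
    have \<phi>i: "integrable (state_law M K) (\<phi> i)" if "i \<in> {1..u}" for i by (rule bi[OF \<phi>m[OF that] \<phi>B[OF that]])
    have \<psi>i: "integrable (state_law M K) (\<psi> i)" if "i \<in> {1..u}" for i by (rule bi[OF \<psi>m[OF that] \<psi>B[OF that]])
    have ti: "integrable (state_law M K) t" by (rule bi[OF tm tB])
    have \<phi>a: "(\<integral>s. \<phi> i s \<partial>state_law M K) = ?a K i" if "i \<in> {1..u}" for i
      unfolding \<phi>_def by (rule integral_score_law[OF f fB K that, symmetric])
    have \<psi>b: "(\<integral>s. \<psi> i s \<partial>state_law M K) = ?b K i" if "i \<in> {1..u}" for i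
      unfolding \<psi>_def by (rule integral_score_law[OF e eB K that, symmetric])
    have KU: "i \<in> {1..u}" if "i \<in> K" for i using KSD(1)[OF K] that by blast
    have "(\<integral>s. t s \<partial>state_law M K) = (\<Sum>i\<in>{1..u}. ?b K i) / real (u - n)"
      unfolding t_def using \<psi>i \<psi>b by simp
    also have "(\<Sum>i\<in>{1..u}. ?b K i) = (\<Sum>i\<in>K. ?b K i) + (\<Sum>i\<in>{1..u} - K. ?b K i)"
      using sum.subset_diff[OF KSD(1)[OF K], of "?b K"] by simp
    finally have T: "(\<integral>s. t s \<partial>state_law M K) = \<dots> / real (u - n)" .
    have "(\<integral>s. F (s, K) \<partial>state_law M K) = (\<integral>s. (\<Sum>i\<in>K. \<phi> i s) - n * (t s - 1) \<partial>state_law M K)"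
      by (simp add: FK[OF K])
    also have "\<dots> = (\<Sum>i\<in>K. \<integral>s. \<phi> i s \<partial>state_law M K) - n * ((\<integral>s. t s \<partial>state_law M K) - 1)"
      using \<phi>i KU ti by (simp add: prob_space)
    also have "(\<Sum>i\<in>K. \<integral>s. \<phi> i s \<partial>state_law M K) = (\<Sum>i\<in>K. ?a K i)"
      by (rule sum.cong[OF refl]) (simp only: \<phi>a[OF KU])
    finally show ?thesis unfolding T .
  qed
  let ?A = "\<Sum>K\<in>KS. \<Sum>i\<in>K. ?a K i" and ?BK = "\<Sum>K\<in>KS. \<Sum>i\<in>K. ?b K i"
    and ?BN = "\<Sum>K\<in>KS. \<Sum>i\<in>{1..u} - K. ?b K i"
  have "(\<integral>x. F x \<partial>J) = (\<Sum>K\<in>KS. \<integral>s. F (s, K) \<partial>state_law M K) / ?N"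
    by (rule integral_joint_law[OF Fm FB])
  also have "(\<Sum>K\<in>KS. \<integral>s. F (s, K) \<partial>state_law M K) =
     (\<Sum>K\<in>KS. (\<Sum>i\<in>K. ?a K i) - n * (((\<Sum>i\<in>K. ?b K i) + (\<Sum>i\<in>{1..u} - K. ?b K i)) / real (u - n) - 1))"
    by (rule sum.cong[OF refl FJ])
  also have "\<dots> = ?A - n * ((?BK + ?BN) / real (u - n) - ?N)"
    by (simp add: sum_subtractf sum.distrib flip: sum_distrib_left sum_divide_distrib)
  finally have FJ': "(\<integral>x. F x \<partial>J) = (?A - n * ((?BK + ?BN) / real (u - n) - ?N)) / ?N" .
  have n0: "real n > 0" using n_pos by simp
  have a: "?A = n * ?N * (\<integral>x. f x \<partial>key_score_law u n M)"
    unfolding integral_key_score_law[OF f fB] using N n0 by (simp flip: sum_divide_distrib)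
  have bk: "?BK = n * ?N * (\<integral>x. exp (f x) \<partial>key_score_law u n M)"
    unfolding integral_key_score_law[OF e eB] using N n0 by (simp flip: sum_divide_distrib)
  have bn: "?BN = real (u - n) * ?N * (\<integral>x. exp (f x) \<partial>nonkey_score_law u n M)"
    unfolding integral_nonkey_score_law[OF e eB] using N un by (simp flip: sum_divide_distrib)
  have "(\<integral>x. F x \<partial>J) = n * ((\<integral>x. f x \<partial>key_score_law u n M)
      - real n / real (u - n) * (\<integral>x. exp (f x) \<partial>key_score_law u n M)
      - (\<integral>x. exp (f x) \<partial>nonkey_score_law u n M) + 1)"
    unfolding FJ' a bk bn using N un by (simp add: field_simps)
  \<comment> \<open>The \<open>+ 1\<close> of the variational bound outweighs
    \<open>\<integral> exp F \<le> 1\<close>, so the budget in nats is at least the mean of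
    \<open>F\<close> under \<open>J\<close>.\<close>
  then show ?thesis using memory_budget_variational[OF Fm FB] expR by linarith
qed

end

section \<open>Asymptotically optimal testers\<close>

text \<open>If the limit failed, infinitely many terms would avoid some neighbourhood of
  \<open>l\<close>; enumerating their indices gives a subsequence none of whose subsequences
  converges to \<open>l\<close>.\<close>

lemma tendsto_of_subsequences:
  fixes X :: "nat \<Rightarrow> 'a::topological_space"
  assumes "\<And>s :: nat \<Rightarrow> nat. strict_mono s \<Longrightarrow> \<exists>r. strict_mono r \<and> (\<lambda>n. X (s (r n))) \<longlonglongrightarrow> l"
  shows "X \<longlonglongrightarrow> l"
proof (rule topological_tendstoI, rule ccontr)
  fix U assume U: "open U" "l \<in> U" and "\<not> (\<forall>\<^sub>F n in sequentially. X n \<in> U)"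
  then have "infinite {n. X n \<notin> U}"
    by (simp add: not_eventually frequently_cofinite flip: cofinite_eq_sequentially)
  then obtain s :: "nat \<Rightarrow> nat" where s: "strict_mono s" "\<And>n. X (s n) \<notin> U"
    using infinite_enumerate by blast
  with assms obtain r where "(\<lambda>n. X (s (r n))) \<longlonglongrightarrow> l" by blast
  then have "\<forall>\<^sub>F n in sequentially. X (s (r n)) \<in> U" using U by (rule topological_tendstoD)
  then show False using s(2) by simp
qed

lemma eventually_less_of_limsup_le:
  fixes x :: "nat \<Rightarrow> real"
  assumes "limsup (\<lambda>j. ereal (x j)) \<le> ereal c" "0 < \<delta>"
  shows "\<forall>\<^sub>F j in sequentially. x j < c + \<delta>"
proof -
  have "limsup (\<lambda>j. ereal (x j)) < ereal (c + \<delta>)"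
    using assms by (intro order.strict_trans1[OF assms(1)]) simp
  from Limsup_lessD[OF this] show ?thesis by simp
qed

text \<open>A limit superior bounds the rates only up to a slack \<open>\<delta>\<close> and only
  eventually. Both are harmless: the limit inferior ignores initial terms, and
  \<open>\<delta>\<close> is arbitrary.\<close>

lemma feasible_of_unit_weak_conv:
  assumes conv: "unit_weak_conv (\<mu> \<circ> q) \<alpha>" and q: "strict_mono q" and d: "lower_semicontinuous_unit d"
    and le: "\<And>j. (\<integral>\<^sup>+x. d x \<partial>\<mu> j) \<le> ennreal (e j)"
    and lim: "limsup (\<lambda>j. ereal (e j)) \<le> ereal \<epsilon>" and "0 \<le> \<epsilon>"
  shows "\<alpha> \<in> feasible d \<epsilon>"
proof -
  have "(\<integral>\<^sup>+x. d x \<partial>\<alpha>) \<le> ennreal \<epsilon> + ennreal \<delta>" if "0 < \<delta>" for \<delta> :: real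
  proof -
    have ev: "\<forall>\<^sub>F j in sequentially. e (q j) < \<epsilon> + \<delta>"
      by (rule eventually_subseq[OF q eventually_less_of_limsup_le[OF lim that]])
    have "(\<integral>\<^sup>+x. d x \<partial>\<alpha>) \<le> liminf (\<lambda>n. \<integral>\<^sup>+x. d x \<partial>(\<mu> \<circ> q) n)"
      by (rule nn_integral_liminf_of_unit_weak_conv[OF conv d])
    also have "\<dots> \<le> liminf (\<lambda>n. ennreal (\<epsilon> + \<delta>))"
    proof (rule Liminf_mono, use ev in eventually_elim)
      case (elim n)
      have "(\<integral>\<^sup>+x. d x \<partial>\<mu> (q n)) \<le> ennreal (e (q n))" by (rule le)
      also have "\<dots> \<le> ennreal (\<epsilon> + \<delta>)" using elim by (intro ennreal_leI) simp
      finally show ?case by simp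
    qed
    also have "\<dots> = ennreal \<epsilon> + ennreal \<delta>" using that \<open>0 \<le> \<epsilon>\<close> by (simp add: Liminf_const)
    finally show ?thesis .
  qed
  then have "(\<integral>\<^sup>+x. d x \<partial>\<alpha>) \<le> ennreal \<epsilon>" by (rule ennreal_le_epsilon)
  then show ?thesis using unit_weak_conv_prob_measures[OF conv] by (simp add: feasible_def)
qed

lemma KL_le_limsup_memory_budget:
  fixes M :: "nat \<Rightarrow> ('r, 'w) tester"
  assumes ratio: "(\<lambda>j. real (n j) / real (u j)) \<longlonglongrightarrow> 0"
    and tester: "\<And>j. membership_tester (u j) (n j) (M j)"
    and q: "strict_mono q"
    and \<alpha>: "unit_weak_conv ((\<lambda>j. key_score_law (u j) (n j) (M j)) \<circ> q) \<alpha>"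
    and \<beta>: "unit_weak_conv ((\<lambda>j. nonkey_score_law (u j) (n j) (M j)) \<circ> q) \<beta>"
  shows "KL \<alpha> \<beta> \<le> limsup (\<lambda>j. ereal (memory_budget (u j) (n j) (M j) / real (n j)))"
proof (rule ereal_le_real)
  \<comment> \<open>Arguing with real upper bounds \<open>z\<close> covers an infinite limit
    superior too, where there is nothing to show.\<close>
  fix z assume z: "limsup (\<lambda>j. ereal (memory_budget (u j) (n j) (M j) / real (n j))) \<le> ereal z"
  have vt: "valid_tester (u j) (n j) (M j)" for j by (simp add: valid_tester_def tester)
  note n_pos = valid_tester.n_pos[OF vt] and n_less = valid_tester.n_less[OF vt]
  \<comment> \<open>Division of numerator and denominator by \<open>u j\<close> turns
    \<open>n / (u - n)\<close> into a continuous expression in the ratio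
    \<open>n / u\<close>.\<close>
  have l1: "(\<lambda>j. (real (n j) / real (u j)) / (1 - real (n j) / real (u j))) \<longlonglongrightarrow> 0 / (1 - 0)"
    by (intro tendsto_intros ratio) simp
  have l2: "(real (n j) / real (u j)) / (1 - real (n j) / real (u j)) = real (n j) / real (u j - n j)" for j
    using n_less[of j] by (simp add: of_nat_diff field_simps)
  have r0: "(\<lambda>j. real (n j) / real (u j - n j)) \<longlonglongrightarrow> 0" using l1 unfolding l2 by simp
  show "KL \<alpha> \<beta> \<le> ereal z"
  proof (rule KL_le_of_continuous_bound[OF unit_weak_conv_prob_measures[OF \<alpha>] unit_weak_conv_prob_measures[OF \<beta>]])
    fix f :: "real \<Rightarrow> real" and B assume f: "continuous_on UNIV f" and fB: "\<And>x. \<bar>f x\<bar> \<le> B"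
    have fm: "f \<in> borel_measurable unit_borel"
      by (rule measurable_restrict_space1[OF borel_measurable_continuous_onI[OF f]])
    have e: "continuous_on UNIV (\<lambda>x. exp (f x))" by (intro continuous_intros f)
    have eB: "\<bar>exp (f x)\<bar> \<le> exp B" for x using fB[of x] by simp
    let ?k = "\<lambda>j. key_score_law (u j) (n j) (M j)" and ?l = "\<lambda>j. nonkey_score_law (u j) (n j) (M j)"
    define G where "G j = (\<integral>x. f x \<partial>?k j) - real (n j) / real (u j - n j) * (\<integral>x. exp (f x) \<partial>?k j)
      - (\<integral>x. exp (f x) \<partial>?l j) + 1" for j
    have "(\<lambda>j. \<integral>x. f x \<partial>?k (q j)) \<longlonglongrightarrow> (\<integral>x. f x \<partial>\<alpha>)"
      "(\<lambda>j. \<integral>x. exp (f x) \<partial>?k (q j)) \<longlonglongrightarrow> (\<integral>x. exp (f x) \<partial>\<alpha>)"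
      "(\<lambda>j. \<integral>x. exp (f x) \<partial>?l (q j)) \<longlonglongrightarrow> (\<integral>x. exp (f x) \<partial>\<beta>)"
      using integral_tendsto_of_unit_weak_conv[OF \<alpha> f fB] integral_tendsto_of_unit_weak_conv[OF \<alpha> e eB]
        integral_tendsto_of_unit_weak_conv[OF \<beta> e eB] by (simp_all add: o_def)
    then have "(\<lambda>j. G (q j)) \<longlonglongrightarrow> (\<integral>x. f x \<partial>\<alpha>) - 0 * (\<integral>x. exp (f x) \<partial>\<alpha>) - (\<integral>x. exp (f x) \<partial>\<beta>) + 1"
      unfolding G_def by (intro tendsto_intros LIMSEQ_subseq_LIMSEQ[OF r0 q, unfolded o_def])
    then have Glim: "(\<lambda>j. G (q j)) \<longlonglongrightarrow> (\<integral>x. f x \<partial>\<alpha>) - (\<integral>x. exp (f x) \<partial>\<beta>) + 1" by simp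
    have Gle: "G j \<le> ln 2 * (memory_budget (u j) (n j) (M j) / real (n j))" for j
      using valid_tester.memory_budget_ge[OF vt fm fB, of j] n_pos[of j] by (simp add: G_def field_simps)
    have "(\<integral>x. f x \<partial>\<alpha>) - (\<integral>x. exp (f x) \<partial>\<beta>) + 1 \<le> z * ln 2 + e" if "0 < e" for e
    proof -
      \<comment> \<open>A slack of \<open>e / ln 2\<close> bits is a slack of \<open>e\<close>
        nats.\<close>
      have "\<forall>\<^sub>F j in sequentially. memory_budget (u (q j)) (n (q j)) (M (q j)) / real (n (q j)) < z + e / ln 2"
        by (rule eventually_subseq[OF q eventually_less_of_limsup_le[OF z]]) (use that in simp)
      then have "\<forall>\<^sub>F j in sequentially. G (q j) \<le> z * ln 2 + e"
      proof eventually_elim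
        case (elim j)
        have "ln 2 * (memory_budget (u (q j)) (n (q j)) (M (q j)) / real (n (q j))) \<le> ln 2 * (z + e / ln 2)"
          using elim by (intro mult_left_mono) auto
        also have "\<dots> = z * ln 2 + e" by (simp add: algebra_simps)
        finally show ?case using Gle[of "q j"] by linarith
      qed
      then show ?thesis by (rule tendsto_upperbound[OF Glim]) simp
    qed
    then show "(\<integral>x. f x \<partial>\<alpha>) - (\<integral>x. exp (f x) \<partial>\<beta>) + 1 \<le> z * ln 2" by (rule field_le_epsilon)
  qed
qed

theorem theorem3p2:
  fixes dK dN :: "real \<Rightarrow> ennreal"
    and \<epsilon>K \<epsilon>N :: real
    and \<mu>K \<mu>N :: "real measure"
    and n u :: "nat \<Rightarrow> nat"
    and M :: "nat \<Rightarrow> ('r, 'w) tester"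
    and eK eN :: "nat \<Rightarrow> real"
  assumes "admissible dK dN"
    and "0 \<le> \<epsilon>K" and "0 \<le> \<epsilon>N"
    and "unique_minimizer (\<lambda>(\<mu>, \<nu>). KL \<mu> \<nu>) (feasible dK \<epsilon>K \<times> feasible dN \<epsilon>N) (\<mu>K, \<mu>N)"
    and "filterlim n at_top sequentially"
    and "(\<lambda>j. real (n j) / real (u j)) \<longlonglongrightarrow> 0"
    and "\<And>j. membership_tester (u j) (n j) (M j)"
    and "\<And>j. 0 \<le> eK j" and "\<And>j. 0 \<le> eN j"
    and "\<And>j. achieves_error_rates dK dN (u j) (n j) (M j) (eK j) (eN j)"
    and "limsup (\<lambda>j. ereal (eK j)) \<le> ereal \<epsilon>K"
    and "limsup (\<lambda>j. ereal (eN j)) \<le> ereal \<epsilon>N"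
    and "limsup (\<lambda>j. ereal (memory_budget (u j) (n j) (M j) / real (n j))) = KL \<mu>K \<mu>N"
  shows "(\<lambda>j. wasserstein1 (key_score_law (u j) (n j) (M j)) \<mu>K) \<longlonglongrightarrow> 0
       \<and> (\<lambda>j. wasserstein1 (nonkey_score_law (u j) (n j) (M j)) \<mu>N) \<longlonglongrightarrow> 0"
proof -
  let ?k = "\<lambda>j. key_score_law (u j) (n j) (M j)" and ?l = "\<lambda>j. nonkey_score_law (u j) (n j) (M j)"
  have vt: "valid_tester (u j) (n j) (M j)" for j by (simp add: valid_tester_def assms(7))
  have lsc: "lower_semicontinuous_unit dK" "lower_semicontinuous_unit dN"
    using assms(1) by (auto simp: admissible_def)
  have err: "(\<integral>\<^sup>+x. dK x \<partial>?k j) \<le> ennreal (eK j)" "(\<integral>\<^sup>+x. dN x \<partial>?l j) \<le> ennreal (eN j)" for j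
    using assms(10)[of j] by (auto simp: achieves_error_rates_def)
  have sub: "\<exists>r. strict_mono r \<and> (\<lambda>j. wasserstein1 (?k (s (r j))) \<mu>K) \<longlonglongrightarrow> 0
      \<and> (\<lambda>j. wasserstein1 (?l (s (r j))) \<mu>N) \<longlonglongrightarrow> 0" if s: "strict_mono s" for s :: "nat \<Rightarrow> nat"
  proof -
    obtain r1 \<alpha> where r1: "strict_mono r1" and \<alpha>1: "unit_weak_conv ((\<lambda>j. ?k (s j)) \<circ> r1) \<alpha>"
      by (rule unit_measures_weakly_compact[OF valid_tester.key_score_law_in[OF vt]])
    \<comment> \<open>Extracting again along \<open>r1\<close> makes both score laws converge along
      the same indices, as required for comparing the divergence of the limits with the
      budgets.\<close>
    obtain r2 \<beta> where r2: "strict_mono r2" and \<beta>1: "unit_weak_conv ((\<lambda>j. ?l (s (r1 j))) \<circ> r2) \<beta>"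
      by (rule unit_measures_weakly_compact[OF valid_tester.nonkey_score_law_in[OF vt]])
    define r where "r = r1 \<circ> r2"
    have r: "strict_mono r" unfolding r_def by (intro strict_mono_o r1 r2)
    define q where "q = s \<circ> r"
    have q: "strict_mono q" unfolding q_def by (intro strict_mono_o s r)
    have \<alpha>: "unit_weak_conv (?k \<circ> q) \<alpha>"
      using unit_weak_conv_subseq[OF \<alpha>1 r2] by (simp add: q_def r_def o_def)
    have \<beta>: "unit_weak_conv (?l \<circ> q) \<beta>"
      using \<beta>1 by (simp add: q_def r_def o_def)
    have "\<alpha> \<in> feasible dK \<epsilon>K"
      by (rule feasible_of_unit_weak_conv[OF \<alpha> q lsc(1) err(1) assms(11,2)])
    moreover have "\<beta> \<in> feasible dN \<epsilon>N"
      by (rule feasible_of_unit_weak_conv[OF \<beta> q lsc(2) err(2) assms(12,3)])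
    moreover have "KL \<alpha> \<beta> \<le> KL \<mu>K \<mu>N"
      using KL_le_limsup_memory_budget[OF assms(6,7) q \<alpha> \<beta>] assms(13) by simp
    moreover have "\<not> KL \<mu> \<nu> < KL \<mu>K \<mu>N" if "\<mu> \<in> feasible dK \<epsilon>K" "\<nu> \<in> feasible dN \<epsilon>N" for \<mu> \<nu>
      using assms(4) that by (auto simp: unique_minimizer_def is_arg_min_def)
    ultimately have "is_arg_min (\<lambda>(\<mu>, \<nu>). KL \<mu> \<nu>) (\<lambda>y. y \<in> feasible dK \<epsilon>K \<times> feasible dN \<epsilon>N) (\<alpha>, \<beta>)"
      unfolding is_arg_min_def by (auto dest: order.strict_trans2)
    \<comment> \<open>Uniqueness forces the same limit pair for every initial subsequence
      \<open>s\<close>, which the subsequence criterion demands.\<close>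
    then have "\<alpha> = \<mu>K" "\<beta> = \<mu>N" using assms(4) unfolding unique_minimizer_def by blast+
    then have "(\<lambda>j. wasserstein1 (?k (s (r j))) \<mu>K) \<longlonglongrightarrow> 0" "(\<lambda>j. wasserstein1 (?l (s (r j))) \<mu>N) \<longlonglongrightarrow> 0"
      using wasserstein1_tendsto_0[OF \<alpha>] wasserstein1_tendsto_0[OF \<beta>] by (simp_all add: q_def o_def)
    with r show ?thesis by (intro exI[of _ r] conjI)
  qed
  show ?thesis
  proof
    show "(\<lambda>j. wasserstein1 (?k j) \<mu>K) \<longlonglongrightarrow> 0"
      by (rule tendsto_of_subsequences) (drule sub, blast)
    show "(\<lambda>j. wasserstein1 (?l j) \<mu>N) \<longlonglongrightarrow> 0"
      by (rule tendsto_of_subsequences) (drule sub, blast)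
  qed
qed

end
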